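(* Let $F$ be a Sturmian set over the alphabet $A$ and let $d\ge1$ be an integer. A bifix code $X\subset F$ is a free basis of a subgroup of index $d$ of the free group $A^\circ$ if and only if $X$ is a finite $F$-maximal bifix code of $F$-degree $d$.
   Context: $A^\circ$ denotes the free group on the finite alphabet $A$, and $A^*$ is viewed as a submonoid of $A^\circ$. A word $u\in F$ is right-special if $ua\in F$ for at least two letters $a$. An infinite word $x$ is episturmian if its set of factors $F(x)$ is closed under reversal and has at most one right-special word of each length; it is strict episturmian if it has exactly one right-special factor of each length and each right-special factor $u$ satisfies $ua\in F(x)$ for all $a\in A$. A Sturmian set is the set of factors of a strict episturmian word. A bifix code is a set of nonempty words none of which is a proper prefix or proper suffix of another; $X\subset F$ is $F$-maximal bifix if not properly contained in a bifix code contained in $F$. A parse of $w$ with respect to $X$ is a triple $(v,x,u)$ with $w=vxu$, $v$ having no suffix in $X$, $x\in X^*$, $u$ having no prefix in $X$; $\delta_X(w)$ is the number of parses and the $F$-degree is $d_F(X)=\max_{w\in F}\delta_X(w)$. *)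

theory Defs
  imports "HOL-Algebra.Coset" "HOL-Algebra.Generated_Groups" "HOL-Library.Sublist" "HOL-Library.Extended_Nat"
begin

definition factors :: "(nat \<Rightarrow> 'a) \<Rightarrow> 'a list set" where
  "factors x = {map x [i..<i+n] | i n. True}"

definition right_special :: "'a set \<Rightarrow> 'a list set \<Rightarrow> 'a list \<Rightarrow> bool" where
  "right_special A F u \<longleftrightarrow> u \<in> F \<and> (\<exists>a\<in>A. \<exists>b\<in>A. a \<noteq> b \<and> u @ [a] \<in> F \<and> u @ [b] \<in> F)"

definition episturmian :: "'a set \<Rightarrow> (nat \<Rightarrow> 'a) \<Rightarrow> bool" where
  "episturmian A x \<longleftrightarrow> (\<forall>i. x i \<in> A) \<and> (\<forall>w\<in>factors x. rev w \<in> factors x)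
     \<and> (\<forall>n. \<forall>u v. right_special A (factors x) u \<and> right_special A (factors x) v
              \<and> length u = n \<and> length v = n \<longrightarrow> u = v)"

definition strict_episturmian :: "'a set \<Rightarrow> (nat \<Rightarrow> 'a) \<Rightarrow> bool" where
  "strict_episturmian A x \<longleftrightarrow> episturmian A x
     \<and> (\<forall>n. \<exists>!u. right_special A (factors x) u \<and> length u = n)
     \<and> (\<forall>u. right_special A (factors x) u \<longrightarrow> (\<forall>a\<in>A. u @ [a] \<in> factors x))"

definition sturmian_set :: "'a set \<Rightarrow> 'a list set \<Rightarrow> bool" where
  "sturmian_set A F \<longleftrightarrow> (\<exists>x. strict_episturmian A x \<and> F = factors x)"

definition bifix_code :: "'a list set \<Rightarrow> bool" where
  "bifix_code X \<longleftrightarrow> (\<forall>u\<in>X. u \<noteq> []) \<and>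
     (\<forall>u\<in>X. \<forall>v\<in>X. \<not> strict_prefix u v \<and> \<not> strict_suffix u v)"

definition F_maximal_bifix :: "'a list set \<Rightarrow> 'a list set \<Rightarrow> bool" where
  "F_maximal_bifix F X \<longleftrightarrow> bifix_code X \<and> X \<subseteq> F \<and>
     (\<forall>Y. bifix_code Y \<and> X \<subseteq> Y \<and> Y \<subseteq> F \<longrightarrow> Y = X)"

definition word_star :: "'a list set \<Rightarrow> 'a list set" where
  "word_star X = {concat ws | ws. set ws \<subseteq> X}"

definition parses :: "'a list set \<Rightarrow> 'a list \<Rightarrow> ('a list \<times> 'a list \<times> 'a list) set" where
  "parses X w = {(v, x, u). w = v @ x @ u \<and> (\<forall>s. suffix s v \<longrightarrow> s \<notin> X)
       \<and> x \<in> word_star X \<and> (\<forall>p. prefix p u \<longrightarrow> p \<notin> X)}"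

definition num_parses :: "'a list set \<Rightarrow> 'a list \<Rightarrow> nat" where
  "num_parses X w = card (parses X w)"

definition F_degree :: "'a list set \<Rightarrow> 'a list set \<Rightarrow> enat" where
  "F_degree F X = (SUP w\<in>F. enat (num_parses X w))"

text \<open>Letters of the free group: (a, False) is a, (a, True) is a^{-1}.\<close>
definition cancels :: "'b \<times> bool \<Rightarrow> 'b \<times> bool \<Rightarrow> bool" where
  "cancels p q \<longleftrightarrow> fst p = fst q \<and> snd p \<noteq> snd q"

fun reduced :: "('b \<times> bool) list \<Rightarrow> bool" where
  "reduced [] = True"
| "reduced [p] = True"
| "reduced (p # q # r) = (\<not> cancels p q \<and> reduced (q # r))"

fun reduce :: "('b \<times> bool) list \<Rightarrow> ('b \<times> bool) list" where
  "reduce [] = []"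
| "reduce (p # r) = (case reduce r of [] \<Rightarrow> [p]
      | q # s \<Rightarrow> (if cancels p q then s else p # q # s))"

definition free_group :: "'a set \<Rightarrow> ('a \<times> bool) list monoid" where
  "free_group A = \<lparr> carrier = {w. set w \<subseteq> A \<times> UNIV \<and> reduced w},
                    mult = (\<lambda>u v. reduce (u @ v)), one = [] \<rparr>"

definition embed_word :: "'a list \<Rightarrow> ('a \<times> bool) list" where
  "embed_word w = map (\<lambda>a. (a, False)) w"

definition eval_word :: "('c, 'm) monoid_scheme \<Rightarrow> ('c \<times> bool) list \<Rightarrow> 'c" where
  "eval_word G ws = foldr (\<lambda>(s, b) acc. (if b then inv\<^bsub>G\<^esub> s else s) \<otimes>\<^bsub>G\<^esub> acc) ws \<one>\<^bsub>G\<^esub>"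

definition free_basis :: "('c, 'm) monoid_scheme \<Rightarrow> 'c set \<Rightarrow> 'c set \<Rightarrow> bool" where
  "free_basis G S H \<longleftrightarrow> S \<subseteq> H \<and> generate G S = H \<and>
     (\<forall>ws. set (map fst ws) \<subseteq> S \<and> reduced ws \<and> ws \<noteq> [] \<longrightarrow> eval_word G ws \<noteq> \<one>\<^bsub>G\<^esub>)"

end

(* Fix n and let a suffix u of a word w of length n be a state over w when u has no prefix in X.
   Reading a letter sends the states over a vertex of the Rauzy graph of order n to those over the
   next vertex (u goes to ua, or to the empty word when ua is in X), injectively since X is a
   suffix code; extend these partial maps to permutations. As there is one left-special word of
   each length, Rauzy graphs fold onto the rose one star at a time, and a family of permutations
   on the edges can be changed at the vertices so as to depend on the label only. This gives an
   action of the free group in which every word of X fixes the empty state. Adding a stack that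
   records the words of X shows that X is free; the action also shows that a factor lying in the
   subgroup H generated by X is a product of words of X. If X is finite and F-maximal, every
   long word has exactly d states, the reading maps are bijections, and the states are the
   cosets of H. Conversely, a basis of a subgroup of index d is finite (Schreier), and distinct
   states over a word lie in distinct cosets, which bounds the degree and forces maximality. *)
theory Submission
  imports Defs
begin

section \<open>Free groups\<close>

text \<open>The reading maps live on the edges of a Rauzy graph, while an action of the free group
  may depend on the letter only; edges with the same label can be extended by unrelated
  permutations. What helps is that deleting the first letter of every vertex merges a single family
  of vertices, whose edges towards the longer left-special word can all be made to carry one
  permutation. The changes of coordinates fix the empty state, so words of \<open>X\<close> still
  return to it. One covering construction serves three times: with a one-element second component
  for saturation, with a stack for freeness, and with sets of states and a coset invariant for the
  index. In the converse the degree is not computed directly: the bound \<open>d\<close> gives a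
  largest number \<open>M\<close> of states, a word attaining \<open>M\<close> gives maximality, and
  the direct implication then identifies \<open>M\<close> with the index.\<close>

definition push :: "'b \<times> bool \<Rightarrow> ('b \<times> bool) list \<Rightarrow> ('b \<times> bool) list" where
  "push p s = (case s of [] \<Rightarrow> [p] | q # t \<Rightarrow> (if cancels p q then t else p # q # t))"

lemma push_simps [simp]:
  "push p [] = [p]"
  "push p (q # t) = (if cancels p q then t else p # q # t)"
  by (simp_all add: push_def)

lemma reduce_Cons: "reduce (p # r) = push p (reduce r)"
  by (simp add: push_def)

declare reduce.simps(2) [simp del]
declare reduce_Cons [simp]

lemma reduced_ConsD: "reduced (p # s) \<Longrightarrow> reduced s"
  by (cases s) auto

lemma reduced_push: "reduced s \<Longrightarrow> reduced (push p s)"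
  by (cases s) (auto dest: reduced_ConsD)

lemma reduced_reduce: "reduced (reduce w)"
  by (induction w) (auto simp: reduced_push)

lemma push_eq_Cons: "reduced (p # s) \<Longrightarrow> push p s = p # s"
  by (cases s) auto

lemma reduce_reduced: "reduced w \<Longrightarrow> reduce w = w"
proof (induction w)
  case (Cons p w)
  then show ?case by (simp add: push_eq_Cons reduced_ConsD)
qed simp

lemma set_push: "set (push p s) \<subseteq> insert p (set s)"
  by (cases s) auto

lemma set_reduce: "set (reduce w) \<subseteq> set w"
proof (induction w)
  case (Cons p w)
  then show ?case using set_push[of p "reduce w"] by auto
qed simp

lemma push_push_cancel:
  assumes "reduced s" "cancels p q"
  shows "push p (push q s) = s"
proof (cases s)
  case Nil
  then show ?thesis using assms by simp
next
  case (Cons r t)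
  show ?thesis
  proof (cases "cancels q r")
    case True
    then have "p = r" using assms(2) by (auto simp: cancels_def prod_eq_iff)
    then show ?thesis using True Cons assms by (simp add: push_eq_Cons)
  next
    case False
    then show ?thesis using Cons assms by simp
  qed
qed

lemma reduced_foldr_push: "reduced s \<Longrightarrow> reduced (foldr push u s)"
  by (induction u) (auto simp: reduced_push)

text \<open>A cancelling pair acts as the identity on reduced words, so a word and its reduction act
  alike. This is van der Waerden's device: associativity of the free group comes from composing the
  maps \<open>push p\<close>.\<close>

lemma foldr_push_reduce:
  assumes "reduced s"
  shows "foldr push (reduce w) s = foldr push w s"
proof (induction w)
  case (Cons p w)
  have "foldr push (push p r) s = push p (foldr push r s)" for r
  proof (cases r)
    case (Cons q t)
    then show ?thesis
      using push_push_cancel[OF reduced_foldr_push[OF assms, of t], of p q] by simp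
  qed simp
  then show ?case using Cons by simp
qed simp

lemma reduce_append: "reduce (u @ v) = foldr push u (reduce v)"
  by (induction u) auto

lemma reduce_reduce_append:
  "reduce (reduce u @ v) = reduce (u @ v)" "reduce (u @ reduce v) = reduce (u @ v)"
  by (simp_all add: reduce_append foldr_push_reduce reduced_reduce reduce_reduced)

definition inverse_word :: "('b \<times> bool) list \<Rightarrow> ('b \<times> bool) list" where
  "inverse_word w = rev (map (\<lambda>(a, b). (a, \<not> b)) w)"

lemma foldr_push_inverse_word:
  "reduced s \<Longrightarrow> foldr push (inverse_word w) (foldr push w s) = s"
proof (induction w arbitrary: s)
  case (Cons p w)
  obtain a b where p: "p = (a, b)" by force
  have "push (a, \<not> b) (push p (foldr push w s)) = foldr push w s"
    by (rule push_push_cancel) (use Cons.prems in \<open>auto simp: reduced_foldr_push p cancels_def\<close>)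
  then show ?case using Cons by (simp add: inverse_word_def p)
qed (simp add: inverse_word_def)

lemma carrier_free_group: "w \<in> carrier (free_group A) \<longleftrightarrow> set w \<subseteq> A \<times> UNIV \<and> reduced w"
  by (simp add: free_group_def)

lemma mult_free_group [simp]: "u \<otimes>\<^bsub>free_group A\<^esub> v = reduce (u @ v)"
  by (simp add: free_group_def)

lemma one_free_group [simp]: "\<one>\<^bsub>free_group A\<^esub> = []"
  by (simp add: free_group_def)

lemma group_free_group: "group (free_group A)"
proof (rule groupI)
  fix u v assume "u \<in> carrier (free_group A)" "v \<in> carrier (free_group A)"
  then show "u \<otimes>\<^bsub>free_group A\<^esub> v \<in> carrier (free_group A)"
    using set_reduce[of "u @ v"] by (auto simp: carrier_free_group reduced_reduce)
next
  fix u assume u: "u \<in> carrier (free_group A)"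
  let ?v = "reduce (inverse_word u)"
  have "?v \<in> carrier (free_group A)"
    using u set_reduce[of "inverse_word u"]
    by (fastforce simp: carrier_free_group reduced_reduce inverse_word_def)
  moreover have "?v \<otimes>\<^bsub>free_group A\<^esub> u = \<one>\<^bsub>free_group A\<^esub>"
    using foldr_push_inverse_word[of "[]" u]
    by (simp add: reduce_reduce_append) (simp add: reduce_append foldr_push_reduce
        flip: reduce_append[of u "[]", simplified])
  ultimately show "\<exists>v\<in>carrier (free_group A). v \<otimes>\<^bsub>free_group A\<^esub> u = \<one>\<^bsub>free_group A\<^esub>" by blast
qed (auto simp: carrier_free_group reduce_reduced reduce_reduce_append)

lemma reduced_embed_word: "reduced (embed_word w)"
proof (induction w)
  case (Cons a w)
  then show ?case by (cases w) (auto simp: embed_word_def cancels_def)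
qed (simp add: embed_word_def)

lemma embed_word_carrier: "set w \<subseteq> A \<Longrightarrow> embed_word w \<in> carrier (free_group A)"
  using reduced_embed_word[of w] by (auto simp: carrier_free_group embed_word_def)

text \<open>Positive letters never cancel, so concatenation in the language is multiplication in the
  free group.\<close>

lemma embed_word_append:
  "embed_word (u @ v) = embed_word u \<otimes>\<^bsub>free_group A\<^esub> embed_word v"
  using reduce_reduced[OF reduced_embed_word[of "u @ v"]] by (simp add: embed_word_def)

lemma inj_embed_word: "inj embed_word"
  unfolding embed_word_def by (rule injI) (simp add: inj_def map_injective)

section \<open>Products of generators and free bases in a group\<close>

lemma (in group) eval_word_closed:
  "set (map fst ws) \<subseteq> carrier G \<Longrightarrow> eval_word G ws \<in> carrier G"
  by (induction ws) (auto simp: eval_word_def)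

lemma eval_word_Nil [simp]: "eval_word G [] = \<one>\<^bsub>G\<^esub>"
  by (simp add: eval_word_def)

lemma eval_word_Cons [simp]:
  "eval_word G ((s, b) # ws) = (if b then inv\<^bsub>G\<^esub> s else s) \<otimes>\<^bsub>G\<^esub> eval_word G ws"
  by (simp add: eval_word_def)

lemma (in group) eval_word_append:
  "set (map fst us) \<subseteq> carrier G \<Longrightarrow> set (map fst vs) \<subseteq> carrier G \<Longrightarrow>
   eval_word G (us @ vs) = eval_word G us \<otimes> eval_word G vs"
proof (induction us)
  case (Cons p us)
  then show ?case by (cases p) (auto simp: m_assoc eval_word_closed)
qed (simp add: eval_word_closed)

lemma (in group) eval_word_reduce:
  assumes "set (map fst ws) \<subseteq> carrier G"
  shows "eval_word G (reduce ws) = eval_word G ws"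
  using assms
proof (induction ws)
  case (Cons p ws)
  have sub: "set (map fst (reduce ws)) \<subseteq> carrier G"
    using Cons.prems set_reduce[of ws] by auto
  obtain s b where p: "p = (s, b)" by force
  have "eval_word G (push p (reduce ws)) = eval_word G (p # reduce ws)"
  proof (cases "reduce ws")
    case (Cons q t)
    obtain s' b' where q: "q = (s', b')" by force
    show ?thesis
    proof (cases "cancels p q")
      case True
      then have "s' = s" "b' = (\<not> b)" by (auto simp: p q cancels_def)
      moreover have "s \<in> carrier G" "eval_word G t \<in> carrier G"
        using Cons.prems sub by (auto simp: p Cons eval_word_closed)
      ultimately show ?thesis using True
        by (cases b) (simp_all add: Cons p q inv_solve_left l_inv r_inv m_assoc[symmetric] del: m_assoc)
    qed (simp add: Cons)
  qed simp
  then show ?case using Cons p by simp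
qed simp

lemma (in group) generate_eval_word:
  assumes "S \<subseteq> carrier G" "y \<in> generate G S"
  shows "\<exists>ws. set (map fst ws) \<subseteq> S \<and> reduced ws \<and> y = eval_word G ws"
proof -
  have "\<exists>ws. set (map fst ws) \<subseteq> S \<and> y = eval_word G ws"
    using assms(2)
  proof (induction rule: generate.induct)
    case one
    show ?case by (intro exI[of _ "[]"]) simp
  next
    case (incl h)
    then show ?case using assms(1) by (intro exI[of _ "[(h, False)]"]) auto
  next
    case (inv h)
    then show ?case using assms(1) by (intro exI[of _ "[(h, True)]"]) auto
  next
    case (eng h1 h2)
    then obtain us vs where "set (map fst us) \<subseteq> S" "h1 = eval_word G us"
      "set (map fst vs) \<subseteq> S" "h2 = eval_word G vs" by blast
    then show ?case using assms(1)
      by (intro exI[of _ "us @ vs"]) (simp add: eval_word_append subset_trans)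
  qed
  then obtain ws where ws: "set (map fst ws) \<subseteq> S" "y = eval_word G ws" by blast
  then show ?thesis using assms(1) set_reduce[of ws]
    by (intro exI[of _ "reduce ws"]) (auto simp: reduced_reduce eval_word_reduce subset_trans)
qed

text \<open>A product involves finitely many generators. Combined with the minimality of free bases,
  this makes every free basis of a finitely generated subgroup finite.\<close>

lemma (in group) generate_finite_support:
  assumes "B \<subseteq> generate G S" "finite B"
  shows "\<exists>S'\<subseteq>S. finite S' \<and> B \<subseteq> generate G S'"
proof -
  have "\<exists>S'\<subseteq>S. finite S' \<and> y \<in> generate G S'" if "y \<in> generate G S" for y
    using that
  proof (induction rule: generate.induct)
    case one
    show ?case by (intro exI[of _ "{}"]) (auto intro: generate.one)
  next
    case (incl h)
    then show ?case by (intro exI[of _ "{h}"]) (auto intro: generate.incl)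
  next
    case (inv h)
    then show ?case by (intro exI[of _ "{h}"]) (auto intro: generate.inv)
  next
    case (eng h1 h2)
    then obtain S1 S2 where "S1 \<subseteq> S" "finite S1" "h1 \<in> generate G S1"
      "S2 \<subseteq> S" "finite S2" "h2 \<in> generate G S2" by blast
    then show ?case
      using mono_generate[of S1 "S1 \<union> S2"] mono_generate[of S2 "S1 \<union> S2"]
      by (intro exI[of _ "S1 \<union> S2"]) (auto intro: generate.eng)
  qed
  then obtain S' where S': "\<And>y. y \<in> B \<Longrightarrow> S' y \<subseteq> S \<and> finite (S' y) \<and> y \<in> generate G (S' y)"
    using assms(1) by (metis subsetD)
  have "B \<subseteq> generate G (\<Union>(S' ` B))"
  proof
    fix y assume "y \<in> B"
    then show "y \<in> generate G (\<Union>(S' ` B))"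
      using S' mono_generate[of "S' y" "\<Union>(S' ` B)"] by blast
  qed
  then show ?thesis using S' assms(2) by (intro exI[of _ "\<Union>(S' ` B)"]) auto
qed

text \<open>Writing some \<open>y\<close> in \<open>S - S'\<close> over \<open>S'\<close> and
  multiplying by its inverse would give a nonempty reduced relation: \<open>(y, True)\<close> cannot
  cancel, as \<open>y\<close> does not occur in the rest.\<close>

lemma (in group) free_basis_minimal:
  assumes "S \<subseteq> carrier G" "free_basis G S H" "S' \<subseteq> S" "generate G S' = H"
  shows "S' = S"
proof (rule ccontr)
  assume "S' \<noteq> S"
  then obtain y where y: "y \<in> S" "y \<notin> S'" using assms(3) by blast
  then have "y \<in> generate G S'" using assms(2,4) by (auto simp: free_basis_def)
  then obtain ws where ws: "set (map fst ws) \<subseteq> S'" "reduced ws" "y = eval_word G ws"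
    using generate_eval_word[of S' y] assms(1,3) by blast
  let ?ws = "(y, True) # ws"
  have "reduced ?ws"
    using ws y(2) by (cases ws) (auto simp: cancels_def)
  moreover have "eval_word G ?ws = \<one>" using ws y(1) assms(1) by auto
  moreover have "set (map fst ?ws) \<subseteq> S" using assms(3) ws(1) y(1) by auto
  ultimately show False using assms(2) unfolding free_basis_def by blast
qed

section \<open>Subgroups of finite index are finitely generated\<close>

lemma snoc_free_group:
  assumes "w @ [p] \<in> carrier (free_group A)"
  shows "w \<in> carrier (free_group A)" "[p] \<in> carrier (free_group A)"
    "w @ [p] = w \<otimes>\<^bsub>free_group A\<^esub> [p]"
proof -
  have "reduced (u @ v) \<Longrightarrow> reduced u" for u v :: "('a \<times> bool) list"
    by (induction u rule: reduced.induct) (auto dest: reduced_ConsD)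
  then show "w \<in> carrier (free_group A)" using assms by (fastforce simp: carrier_free_group)
  show "[p] \<in> carrier (free_group A)" using assms by (auto simp: carrier_free_group)
  show "w @ [p] = w \<otimes>\<^bsub>free_group A\<^esub> [p]"
    using assms reduce_reduced[of "w @ [p]"] by (simp add: carrier_free_group)
qed

lemma inv_letter_free_group:
  assumes "a \<in> A"
  shows "inv\<^bsub>free_group A\<^esub> [(a, b)] = [(a, \<not> b)]"
proof -
  interpret group "free_group A" by (rule group_free_group)
  show ?thesis
    by (rule inv_equality) (use assms in \<open>auto simp: carrier_free_group cancels_def\<close>)
qed

text \<open>Schreier's argument: fix a representative of each coset; the finitely many elements comparing
  the representatives along the letters already generate the subgroup.\<close>

lemma finite_index_finitely_generated:
  assumes "finite A" "subgroup H (free_group A)" "finite (rcosets\<^bsub>free_group A\<^esub> H)"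
  shows "\<exists>B. finite B \<and> B \<subseteq> H \<and> generate (free_group A) B = H"
proof -
  let ?G = "free_group A"
  interpret group ?G by (rule group_free_group)
  interpret H: subgroup H ?G by (rule assms(2))
  note [simp del] = mult_free_group one_free_group
  \<comment> \<open>The subgroup itself is represented by the identity; this is what turns
    \<open>compare\<close> into membership of \<open>w\<close> in the end, for \<open>w\<close> in
    \<open>H\<close>.\<close>
  have ex: "\<exists>t. t \<in> carrier ?G \<and> c = H #>\<^bsub>?G\<^esub> t \<and> (c = H \<longrightarrow> t = \<one>\<^bsub>?G\<^esub>)"
    if c: "c \<in> rcosets\<^bsub>?G\<^esub> H" for c
  proof (cases "c = H")
    case True
    then show ?thesis by (intro exI[of _ "\<one>\<^bsub>?G\<^esub>"]) (simp add: coset_mult_one H.subset)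
  next
    case False
    then show ?thesis using c by (auto simp: RCOSETS_def)
  qed
  define t where "t c = (SOME t. t \<in> carrier ?G \<and> c = H #>\<^bsub>?G\<^esub> t \<and> (c = H \<longrightarrow> t = \<one>\<^bsub>?G\<^esub>))" for c
  have t: "t c \<in> carrier ?G" "c = H #>\<^bsub>?G\<^esub> t c" "c = H \<Longrightarrow> t c = \<one>\<^bsub>?G\<^esub>"
    if "c \<in> rcosets\<^bsub>?G\<^esub> H" for c
    using someI_ex[OF ex[OF that]] unfolding t_def by blast+
  define r where "r w = t (H #>\<^bsub>?G\<^esub> w)" for w
  have r: "r w \<in> carrier ?G" "H #>\<^bsub>?G\<^esub> r w = H #>\<^bsub>?G\<^esub> w" if "w \<in> carrier ?G" for w
    using t[of "H #>\<^bsub>?G\<^esub> w"] that by (auto simp: r_def RCOSETS_def)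
  have r_eq: "r w = r w'" if "H #>\<^bsub>?G\<^esub> w = H #>\<^bsub>?G\<^esub> w'" for w w'
    using that by (simp add: r_def)
  define s where "s w a = r w \<otimes>\<^bsub>?G\<^esub> [(a, False)] \<otimes>\<^bsub>?G\<^esub> inv\<^bsub>?G\<^esub> r (w \<otimes>\<^bsub>?G\<^esub> [(a, False)])" for w a
  define B where "B = {s w a | w a. w \<in> carrier ?G \<and> a \<in> A}"
  have let_in: "[(a, b)] \<in> carrier ?G" if "a \<in> A" for a b
    using that by (simp add: carrier_free_group)
  have coset_step: "H #>\<^bsub>?G\<^esub> (r w \<otimes>\<^bsub>?G\<^esub> y) = H #>\<^bsub>?G\<^esub> (w \<otimes>\<^bsub>?G\<^esub> y)"
    if "w \<in> carrier ?G" "y \<in> carrier ?G" for w y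
    using that r by (metis H.subset coset_mult_assoc)
  have "B \<subseteq> (\<lambda>(c, a). t c \<otimes>\<^bsub>?G\<^esub> [(a, False)] \<otimes>\<^bsub>?G\<^esub> inv\<^bsub>?G\<^esub> t (c #>\<^bsub>?G\<^esub> [(a, False)])) ` ((rcosets\<^bsub>?G\<^esub> H) \<times> A)"
  proof
    fix y assume "y \<in> B"
    then obtain w a where w: "w \<in> carrier ?G" "a \<in> A" "y = s w a" by (auto simp: B_def)
    have "H #>\<^bsub>?G\<^esub> w \<in> rcosets\<^bsub>?G\<^esub> H" using w by (auto simp: RCOSETS_def)
    moreover have "(H #>\<^bsub>?G\<^esub> w) #>\<^bsub>?G\<^esub> [(a, False)] = H #>\<^bsub>?G\<^esub> (w \<otimes>\<^bsub>?G\<^esub> [(a, False)])"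
      using w let_in by (simp add: coset_mult_assoc H.subset)
    ultimately show "y \<in> (\<lambda>(c, a). t c \<otimes>\<^bsub>?G\<^esub> [(a, False)] \<otimes>\<^bsub>?G\<^esub> inv\<^bsub>?G\<^esub> t (c #>\<^bsub>?G\<^esub> [(a, False)])) ` ((rcosets\<^bsub>?G\<^esub> H) \<times> A)"
      using w by (intro image_eqI[of _ _ "(H #>\<^bsub>?G\<^esub> w, a)"]) (auto simp: s_def r_def)
  qed
  then have fin: "finite B" using assms(1,3) by (meson finite_SigmaI finite_imageI finite_subset)
  have BH: "B \<subseteq> H"
  proof
    fix y assume "y \<in> B"
    then obtain w a where w: "w \<in> carrier ?G" "a \<in> A" "y = s w a" by (auto simp: B_def)
    let ?v = "w \<otimes>\<^bsub>?G\<^esub> [(a, False)]"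
    have v: "?v \<in> carrier ?G" using w let_in by simp
    have "H #>\<^bsub>?G\<^esub> (r w \<otimes>\<^bsub>?G\<^esub> [(a, False)]) = H #>\<^bsub>?G\<^esub> r ?v"
      using coset_step[OF w(1) let_in[OF w(2)]] r(2)[OF v] by simp
    then have "H #>\<^bsub>?G\<^esub> y = H"
      unfolding w(3) s_def using r(1)[OF w(1)] r(1)[OF v] let_in[OF w(2)]
      by (intro coset_mult_inv2) (simp_all add: H.subset)
    then show "y \<in> H" using r(1)[OF w(1)] r(1)[OF v] let_in[OF w(2)] w(3) assms(2)
      by (metis coset_join1 H.subset s_def inv_closed m_closed)
  qed
  let ?K = "generate ?G B"
  have BG: "B \<subseteq> carrier ?G" using BH H.subset by blast
  interpret K: subgroup ?K ?G by (rule generate_is_subgroup[OF BG])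
  have KH: "?K \<subseteq> H" by (rule generate_subgroup_incl[OF BH assms(2)])
  have compare: "w \<otimes>\<^bsub>?G\<^esub> inv\<^bsub>?G\<^esub> r w \<in> ?K" if "w \<in> carrier ?G" for w
    using that
  proof (induction w rule: rev_induct)
    case Nil
    have "r [] = \<one>\<^bsub>?G\<^esub>"
      using t(3)[of H] H.subset
      by (simp add: r_def coset_mult_one flip: one_free_group[of A])
         (metis H.rcosets_non_empty H.subgroup_in_rcosets group_axioms)
    then show ?case by (simp add: generate.one flip: one_free_group[of A])
  next
    case (snoc p w)
    note w = snoc_free_group[OF snoc.prems]
    obtain a b where p: "p = (a, b)" by force
    have a: "a \<in> A" using w(2) by (simp add: p carrier_free_group)
    let ?v = "w @ [p]"
    have IH: "w \<otimes>\<^bsub>?G\<^esub> inv\<^bsub>?G\<^esub> r w \<in> ?K" by (rule snoc.IH[OF w(1)])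
    have rw: "r w \<in> carrier ?G" and rv: "r ?v \<in> carrier ?G" using r w(1) snoc.prems by auto
    have step: "r w \<otimes>\<^bsub>?G\<^esub> [p] \<otimes>\<^bsub>?G\<^esub> inv\<^bsub>?G\<^esub> r ?v \<in> ?K"
    proof (cases b)
      case False
      then have "s w a \<in> B" "s w a = r w \<otimes>\<^bsub>?G\<^esub> [p] \<otimes>\<^bsub>?G\<^esub> inv\<^bsub>?G\<^esub> r ?v"
        using w a by (auto simp: B_def s_def p)
      then show ?thesis by (metis generate.incl)
    next
      case True
      \<comment> \<open>An inverse letter runs backwards along the edge from \<open>?v\<close> to
        \<open>w\<close>, which contributes the inverse of a Schreier generator.\<close>
      have pinv: "[(a, False)] = inv\<^bsub>?G\<^esub> [p]" using inv_letter_free_group[OF a, of b] True by (simp add: p)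
      have "?v \<otimes>\<^bsub>?G\<^esub> [(a, False)] = w"
        using w by (simp add: pinv m_assoc)
      then have "s ?v a = r ?v \<otimes>\<^bsub>?G\<^esub> inv\<^bsub>?G\<^esub> [p] \<otimes>\<^bsub>?G\<^esub> inv\<^bsub>?G\<^esub> r w"
        by (simp add: s_def pinv)
      then have "inv\<^bsub>?G\<^esub> s ?v a = r w \<otimes>\<^bsub>?G\<^esub> [p] \<otimes>\<^bsub>?G\<^esub> inv\<^bsub>?G\<^esub> r ?v"
        using rw rv w(2) by (simp add: inv_mult_group m_assoc)
      moreover have "s ?v a \<in> B" using snoc.prems a by (auto simp: B_def)
      ultimately show ?thesis by (metis generate.inv)
    qed
    have "?v \<otimes>\<^bsub>?G\<^esub> inv\<^bsub>?G\<^esub> r ?v = (w \<otimes>\<^bsub>?G\<^esub> inv\<^bsub>?G\<^esub> r w) \<otimes>\<^bsub>?G\<^esub> (r w \<otimes>\<^bsub>?G\<^esub> [p] \<otimes>\<^bsub>?G\<^esub> inv\<^bsub>?G\<^esub> r ?v)"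
    proof -
      have "inv\<^bsub>?G\<^esub> r w \<otimes>\<^bsub>?G\<^esub> (r w \<otimes>\<^bsub>?G\<^esub> ([p] \<otimes>\<^bsub>?G\<^esub> inv\<^bsub>?G\<^esub> r ?v)) = [p] \<otimes>\<^bsub>?G\<^esub> inv\<^bsub>?G\<^esub> r ?v"
        using rw rv w(2) by (simp flip: m_assoc)
      then show ?thesis using w rw rv by (simp add: m_assoc)
    qed
    then show ?case using generate.eng[OF IH step] by simp
  qed
  have rH: "r w = \<one>\<^bsub>?G\<^esub>" if "w \<in> H" for w
    using that t(3)[of H] H.subset H.rcos_const[OF group_axioms that] H.subgroup_in_rcosets[OF group_axioms]
    by (simp add: r_def)
  have "H \<subseteq> ?K"
  proof
    fix w assume w: "w \<in> H"
    then have "w \<in> carrier ?G" using H.subset by blast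
    then show "w \<in> ?K" using compare[of w] rH[OF w] by simp
  qed
  then show ?thesis using fin BH KH by blast
qed

lemma free_basis_finite_index_finite:
  assumes "finite A" "subgroup H (free_group A)" "finite (rcosets\<^bsub>free_group A\<^esub> H)"
    "free_basis (free_group A) S H"
  shows "finite S"
proof -
  interpret group "free_group A" by (rule group_free_group)
  obtain B where B: "finite B" "B \<subseteq> H" "generate (free_group A) B = H"
    using finite_index_finitely_generated[OF assms(1-3)] by blast
  have S: "S \<subseteq> carrier (free_group A)"
    using assms(2,4) by (auto simp: free_basis_def dest: subgroup.subset)
  have gen: "generate (free_group A) S = H" using assms(4) by (simp add: free_basis_def)
  obtain S' where S': "S' \<subseteq> S" "finite S'" "B \<subseteq> generate (free_group A) S'"
    using generate_finite_support[of B S] B gen by auto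
  have "H \<subseteq> generate (free_group A) S'"
    using B(3) S' S generate_subgroup_incl[OF S'(3) generate_is_subgroup] by blast
  moreover have "generate (free_group A) S' \<subseteq> H" using gen mono_generate[OF S'(1)] by simp
  ultimately have "S' = S" using free_basis_minimal[OF S assms(4) S'(1)] by blast
  then show ?thesis using S'(2) by simp
qed

section \<open>Permutation actions of the free group\<close>

definition letter_perm :: "('a \<Rightarrow> 's \<Rightarrow> 's) \<Rightarrow> 'a \<times> bool \<Rightarrow> 's \<Rightarrow> 's" where
  "letter_perm g p = (if snd p then inv_into UNIV (g (fst p)) else g (fst p))"

text \<open>With \<open>fold\<close> the first letter acts first, so this is a right action, in step
  with right cosets.\<close>

definition word_perm :: "('a \<Rightarrow> 's \<Rightarrow> 's) \<Rightarrow> ('a \<times> bool) list \<Rightarrow> 's \<Rightarrow> 's" where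
  "word_perm g w = fold (letter_perm g) w"

lemma word_perm_reduce:
  assumes "\<And>a. bij (g a)"
  shows "word_perm g (reduce w) = word_perm g w"
proof (induction w)
  case (Cons p w)
  have "letter_perm g q \<circ> letter_perm g p = id" if "cancels p q" for p q
    using that assms by (cases p; cases q)
      (auto simp: cancels_def letter_perm_def fun_eq_iff bij_is_inj bij_is_surj surj_f_inv_f)
  then have "word_perm g (push p r) = word_perm g (p # r)" for r
    by (cases r) (auto simp: word_perm_def comp_assoc)
  then show ?case using Cons by (simp add: word_perm_def)
qed simp

lemma word_perm_mult:
  assumes "\<And>a. bij (g a)"
  shows "word_perm g (u \<otimes>\<^bsub>free_group A\<^esub> v) s = word_perm g v (word_perm g u s)"
  using word_perm_reduce[of g "u @ v", OF assms] by (simp add: word_perm_def)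

lemma word_perm_inv:
  assumes "\<And>a. bij (g a)" "u \<in> carrier (free_group A)"
  shows "word_perm g (inv\<^bsub>free_group A\<^esub> u) (word_perm g u s) = s"
proof -
  interpret group "free_group A" by (rule group_free_group)
  show ?thesis
    using word_perm_mult[where g = g and u = u and v = "inv\<^bsub>free_group A\<^esub> u" and s = s and A = A, OF assms(1)] r_inv[OF assms(2)]
    by (simp del: mult_free_group) (simp add: word_perm_def)
qed

lemma word_perm_embed_word: "word_perm g (embed_word w) = fold g w"
  by (induction w) (simp_all add: word_perm_def embed_word_def letter_perm_def)

text \<open>The stabiliser of \<open>s\<close> is a subgroup, so the generators decide.\<close>

lemma word_perm_generate_fixes:
  assumes "\<And>a. bij (g a)" "S \<subseteq> carrier (free_group A)"
    "\<And>y. y \<in> S \<Longrightarrow> word_perm g y s = s" "h \<in> generate (free_group A) S"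
  shows "word_perm g h s = s"
  using assms(4)
proof (induction rule: generate.induct)
  case one
  then show ?case by (simp add: word_perm_def)
next
  case (incl h)
  then show ?case using assms(3) by simp
next
  case (inv h)
  then show ?case using assms(3)[OF inv] assms(2) word_perm_inv[of g h A s, OF assms(1)] by auto
next
  case (eng h1 h2)
  then show ?case using word_perm_mult[where g = g and u = h1 and v = h2 and s = s and A = A, OF assms(1)] by simp
qed

section \<open>Factors of strict episturmian words\<close>

text \<open>The special words are mirrored with respect to the definition of a strict episturmian
  word: states are suffixes, so Rauzy graphs get shortened on the left, and left-special words tell
  which vertices merge.\<close>

locale sturmian_language =
  fixes A :: "'a set" and F :: "'a list set"
  assumes letters: "w \<in> F \<Longrightarrow> set w \<subseteq> A"
    and factorial: "u @ v @ w \<in> F \<Longrightarrow> v \<in> F"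
    and recurrent: "u \<in> F \<Longrightarrow> v \<in> F \<Longrightarrow> \<exists>z. u @ z @ v \<in> F"
    and two_letters: "\<exists>a\<in>A. \<exists>b\<in>A. a \<noteq> b"
    and left_special: "\<exists>l. length l = n \<and> (\<forall>a\<in>A. a # l \<in> F) \<and>
      (\<forall>v a b. length v = n \<and> a # v \<in> F \<and> b # v \<in> F \<and> a \<noteq> b \<longrightarrow> v = l)"
begin

lemma ConsD: "a # v \<in> F \<Longrightarrow> v \<in> F"
  using factorial[of "[a]" v "[]"] by simp

lemma appendD1: "u @ v \<in> F \<Longrightarrow> u \<in> F"
  using factorial[of "[]" u v] by simp

lemma appendD2: "u @ v \<in> F \<Longrightarrow> v \<in> F"
  using factorial[of u v "[]"] by simp

lemma drop_in: "w \<in> F \<Longrightarrow> drop k w \<in> F"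
  using appendD2[of "take k w" "drop k w"] by simp

lemma tl_in: "e \<in> F \<Longrightarrow> tl e \<in> F"
  by (cases e) (auto dest: ConsD)

lemma butlast_in: "e \<in> F \<Longrightarrow> butlast e \<in> F"
  by (cases e rule: rev_cases) (auto dest: appendD1)

lemma letter_in: "a \<in> A \<Longrightarrow> [a] \<in> F"
  using left_special[of 0] by auto

lemma Nil_in: "[] \<in> F"
  using two_letters letter_in ConsD by blast

lemma left_extendable: "v \<in> F \<Longrightarrow> \<exists>b. b # v \<in> F"
proof -
  assume v: "v \<in> F"
  obtain a where "[a] \<in> F" using two_letters letter_in by blast
  then obtain z where "[a] @ z @ v \<in> F" using v recurrent by blast
  then have "last (a # z) # v \<in> F"
    using appendD2[of "butlast (a # z)" "last (a # z) # v"] append_butlast_last_id[of "a # z"]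
    by (metis append.assoc append_Cons append_Nil list.distinct(1))
  then show ?thesis by blast
qed

lemma left_extendable_length: "v \<in> F \<Longrightarrow> \<exists>y. length y = n \<and> y @ v \<in> F"
proof (induction n)
  case (Suc n)
  then obtain y where y: "length y = n" "y @ v \<in> F" by blast
  then obtain b where "b # y @ v \<in> F" using left_extendable by blast
  then show ?case using y by (intro exI[of _ "b # y"]) simp
qed simp

lemma ex_length: "\<exists>w\<in>F. length w = n"
  using left_extendable_length[OF Nil_in] by auto

text \<open>A prefix of a left-special word is left-special, so by uniqueness the left-special words
  of consecutive lengths are \<open>l\<close> and \<open>l @ [b0]\<close>. The words
  \<open>a # l\<close> are the vertices that merge, the words \<open>a # l @ [b0]\<close> the edges
  of the star.\<close>

lemma left_special_step:
  "\<exists>l b0. length l = n \<and> b0 \<in> A \<and> (\<forall>a\<in>A. a # l @ [b0] \<in> F)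
    \<and> (\<forall>v a b. length v = n \<and> a # v \<in> F \<and> b # v \<in> F \<and> a \<noteq> b \<longrightarrow> v = l)
    \<and> (\<forall>v a b. length v = Suc n \<and> a # v \<in> F \<and> b # v \<in> F \<and> a \<noteq> b \<longrightarrow> v = l @ [b0])"
proof -
  obtain l' where l': "length l' = Suc n" "\<And>a. a \<in> A \<Longrightarrow> a # l' \<in> F"
    "\<And>v a b. length v = Suc n \<Longrightarrow> a # v \<in> F \<Longrightarrow> b # v \<in> F \<Longrightarrow> a \<noteq> b \<Longrightarrow> v = l'"
    using left_special[of "Suc n"] by metis
  obtain l b0 where lb: "l' = l @ [b0]" using l'(1) by (cases l' rule: rev_cases) auto
  obtain l1 where l1: "length l1 = n"
    "\<And>v a b. length v = n \<Longrightarrow> a # v \<in> F \<Longrightarrow> b # v \<in> F \<Longrightarrow> a \<noteq> b \<Longrightarrow> v = l1"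
    using left_special[of n] by metis
  obtain a b where ab: "a \<in> A" "b \<in> A" "a \<noteq> b" using two_letters by blast
  have "a # l \<in> F" "b # l \<in> F"
    using l'(2)[OF ab(1)] l'(2)[OF ab(2)] appendD1[of "a # l" "[b0]"] appendD1[of "b # l" "[b0]"] lb by auto
  then have "l1 = l" using l1 l'(1) lb ab(3) by force
  moreover have "b0 \<in> A" using letters l'(2)[OF ab(1)] lb by fastforce
  ultimately show ?thesis using l' l1 lb by (intro exI[of _ l] exI[of _ b0]) auto
qed

text \<open>A family \<open>f\<close> of permutations on the edges of the Rauzy graph of order \<open>n\<close> (the edge
  \<open>e\<close> goes from \<open>butlast e\<close> to \<open>tl e\<close>) becomes, after the change of coordinates \<open>h\<close> at the
  vertices, a family depending only on the last letter of the edge. The reason is that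
  passing from order \<open>n + 1\<close> to order \<open>n\<close> only folds a star of edges having a common end,
  the left-special word. The partial maps \<open>k\<close>, known on \<open>D\<close>, are not affected by \<open>h\<close>;
  \<open>\<tau>\<close> is an invariant that \<open>f\<close> transports on the sets \<open>E\<close> by \<open>act\<close>.\<close>

lemma rauzy_gauge:
  fixes f :: "'a list \<Rightarrow> 's \<Rightarrow> 's" and E D :: "'a list \<Rightarrow> 's set"
  assumes bij: "\<And>e. e \<in> F \<Longrightarrow> length e = Suc n \<Longrightarrow> bij (f e)"
    and E: "\<And>e. e \<in> F \<Longrightarrow> length e = Suc n \<Longrightarrow> f e ` E (butlast e) = E (tl e)"
    and C: "\<And>w s. w \<in> F \<Longrightarrow> length w = n \<Longrightarrow> s \<in> E w \<Longrightarrow> \<tau> s \<in> C"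
    and \<tau>: "\<And>e s. e \<in> F \<Longrightarrow> length e = Suc n \<Longrightarrow> s \<in> E (butlast e) \<Longrightarrow> \<tau> (f e s) = act (last e) (\<tau> s)"
    and k: "\<And>e s. e \<in> F \<Longrightarrow> length e = Suc n \<Longrightarrow> s \<in> D (butlast e) \<Longrightarrow> k (last e) s \<in> D (tl e) \<Longrightarrow>
      f e s = k (last e) s"
    and D_Cons: "\<And>b v. D v \<subseteq> D (b # v)"
    and D_snoc: "\<And>v s a. s \<in> D v \<Longrightarrow> k a s \<in> D (v @ [a])"
    and act: "\<And>a. a \<in> A \<Longrightarrow> inj_on (act a) C"
  shows "\<exists>g h E0. (\<forall>a. bij (g a))
    \<and> (\<forall>w\<in>F. length w = n \<longrightarrow> bij (h w) \<and> h w ` E w = E0 \<and> (\<forall>s\<in>D []. h w s = s)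
          \<and> (\<forall>s\<in>E w. \<tau> (h w s) = \<tau> s))
    \<and> (\<forall>e\<in>F. length e = Suc n \<longrightarrow> (\<forall>s. g (last e) (h (butlast e) s) = h (tl e) (f e s)))"
  using bij E C \<tau> k
proof (induction n arbitrary: f E)
  case (0 f E)
  \<comment> \<open>At order 0 the empty word is the only vertex and the edges are single letters;
    letters outside the language get the identity.\<close>
  show ?case
  proof (intro exI conjI ballI impI allI)
    show "bij ((\<lambda>a. if [a] \<in> F then f [a] else id) a)" for a
      using "0.prems"(1) bij_id[unfolded id_def] by simp
    show "(\<lambda>a. if [a] \<in> F then f [a] else id) (last e) (id s) = id (f e s)"
      if "e \<in> F" "length e = Suc 0" for e s
      using that by (cases e) auto
  qed (auto simp: bij_id[unfolded id_def])
next
  case (Suc n f E)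
  note bij = Suc.prems(1) and E = Suc.prems(2) and C = Suc.prems(3)
    and \<tau> = Suc.prems(4) and k = Suc.prems(5)
  obtain l b0 where l: "length l = n" and b0: "b0 \<in> A" and star: "\<And>a. a \<in> A \<Longrightarrow> a # l @ [b0] \<in> F"
    and fib: "\<And>v a b. length v = n \<Longrightarrow> a # v \<in> F \<Longrightarrow> b # v \<in> F \<Longrightarrow> a \<noteq> b \<Longrightarrow> v = l"
    and fib': "\<And>v a b. length v = Suc n \<Longrightarrow> a # v \<in> F \<Longrightarrow> b # v \<in> F \<Longrightarrow> a \<noteq> b \<Longrightarrow> v = l @ [b0]"
    using left_special_step[of n] by metis
  have hdA: "hd w \<in> A" if "w \<in> F" "length w = Suc m" for w m
    using that letters by (cases w) fastforce+
  txt \<open>The base point of the star is its central vertex if that vertex belongs to the fibre.\<close>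
  obtain b1 where b1: "b1 \<in> A" and b1': "\<And>b. b # l = l @ [b0] \<Longrightarrow> b = b1"
  proof (cases "\<exists>b. b # l = l @ [b0]")
    case True
    then obtain b where b: "b # l = l @ [b0]" by blast
    then have "set (b # l) = set (l @ [b0])" by simp
    moreover have "set (l @ [b0]) \<subseteq> A" using star[OF b0] letters by fastforce
    ultimately have "b \<in> A" by auto
    then show ?thesis using that[of b] b by (metis list.inject)
  next
    case False
    then show ?thesis using that b0 by blast
  qed
  let ?f1 = "f (b1 # l @ [b0])"
  \<comment> \<open>In these coordinates every edge of the star carries \<open>?f1\<close>, the
    permutation of the base edge.\<close>
  define h1 where "h1 w = (if tl w = l then inv_into UNIV ?f1 \<circ> f (w @ [b0]) else id)" for w
  have f1: "bij ?f1" using bij[OF star[OF b1]] l by simp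
  have star': "w @ [b0] \<in> F" "w = hd w # l" if "w \<in> F" "length w = Suc n" "tl w = l" for w
    using star[OF hdA[OF that(1,2)]] that by (cases w; auto)+
  have star_E: "f (w @ [b0]) ` E w = E (l @ [b0])" if w: "w \<in> F" "length w = Suc n" "tl w = l" for w
  proof -
    obtain b where "w = b # l" using w by (cases w) auto
    then show ?thesis using E[OF star'(1)[OF w]] l by (simp add: butlast_append)
  qed
  have b1l: "b1 # l \<in> F" using appendD1[of "b1 # l" "[b0]"] star[OF b1] by simp
  have star_E1: "?f1 ` E (b1 # l) = E (l @ [b0])" using star_E[of "b1 # l"] b1l l by simp
  have bijh: "bij (h1 w)" if w: "w \<in> F" "length w = Suc n" for w
    using bij[of "w @ [b0]"] w star'(1)[OF w] bij_imp_bij_inv[OF f1]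
    by (auto simp: h1_def intro: bij_comp)
  have h1_b1: "h1 (b1 # l) = id"
    using f1 by (simp add: h1_def fun_eq_iff bij_is_inj)
  \<comment> \<open>The centre is itself a merging vertex when \<open>l\<close> is a power of
    \<open>b0\<close>; the choice of \<open>b1\<close> leaves its coordinates alone even then, so
    the common target of the star does not move.\<close>
  have h1_l: "h1 (l @ [b0]) = id"
  proof (cases "tl (l @ [b0]) = l")
    case True
    then have "l @ [b0] = hd (l @ [b0]) # l" by (metis append_is_Nil_conv list.collapse not_Cons_self2)
    then show ?thesis using b1' h1_b1 by metis
  qed (simp add: h1_def)
  have f1_h1: "?f1 (h1 w s) = f (w @ [b0]) s" if "tl w = l" for w s
    using f1 that by (simp add: h1_def bij_is_surj surj_f_inv_f)
  have \<tau>_h1: "\<tau> (h1 w s) = \<tau> s" "h1 w s \<in> E (b1 # l) \<or> tl w \<noteq> l"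
    if w: "w \<in> F" "length w = Suc n" and s: "s \<in> E w" for w s
  proof -
    have "h1 w s \<in> E (b1 # l) \<and> \<tau> (h1 w s) = \<tau> s" if tl: "tl w = l"
    proof
      note star_E[OF w tl] star_E1
      moreover have "f (w @ [b0]) s \<in> f (w @ [b0]) ` E w" using s by blast
      ultimately obtain t where t: "t \<in> E (b1 # l)" "?f1 t = ?f1 (h1 w s)"
        using f1_h1[OF tl] by (metis imageE)
      then show mem: "h1 w s \<in> E (b1 # l)" using f1 by (metis bij_pointE)
      \<comment> \<open>The edges from \<open>w\<close> and from \<open>b1 # l\<close> both read
        \<open>b0\<close> and lead to the same state; injectivity of \<open>act b0\<close> on
        \<open>C\<close> gives equal invariants at their sources.\<close>
      have "act b0 (\<tau> (h1 w s)) = \<tau> (?f1 (h1 w s))"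
        using \<tau>[OF star[OF b1], of "h1 w s"] l mem by (simp add: butlast_append)
      also have "\<dots> = act b0 (\<tau> s)"
        using \<tau>[OF star'(1)[OF w tl], of s] w s by (simp add: f1_h1[OF tl])
      finally show "\<tau> (h1 w s) = \<tau> s"
        using act[OF b0] C[OF w s] C[OF b1l _ mem] l by (auto dest: inj_onD)
    qed
    then show "\<tau> (h1 w s) = \<tau> s" "h1 w s \<in> E (b1 # l) \<or> tl w \<noteq> l" by (auto simp: h1_def)
  qed
  have E_h1: "h1 w ` E w = E (b1 # l)" if w: "w \<in> F" "length w = Suc n" "tl w = l" for w
  proof
    show "h1 w ` E w \<subseteq> E (b1 # l)" using \<tau>_h1(2)[OF w(1,2)] w(3) by auto
    show "E (b1 # l) \<subseteq> h1 w ` E w"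
    proof
      fix t assume "t \<in> E (b1 # l)"
      then have "?f1 t \<in> f (w @ [b0]) ` E w"
        using star_E[OF w] star_E1 by blast
      then obtain s where "s \<in> E w" "?f1 t = ?f1 (h1 w s)" using f1_h1[OF w(3)] by auto
      then show "t \<in> h1 w ` E w" using f1 by (metis bij_pointE imageI)
    qed
  qed
  \<comment> \<open>On the known part both star edges act as \<open>k b0\<close>, so comparing them
    yields the identity there.\<close>
  have h1_D: "h1 w s = s" if w: "w \<in> F" "length w = Suc n" and s: "s \<in> D (tl w)" for w s
  proof (cases "tl w = l")
    case True
    have "k b0 s \<in> D (l @ [b0])" using D_snoc s True by blast
    then have "f (w @ [b0]) s = k b0 s" "?f1 s = k b0 s"
      using k[OF star'(1)[OF w True], of s] k[OF star[OF b1], of s] w True l s D_Cons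
        star'(2)[OF w True] by (auto simp: butlast_append) (metis append_Cons list.sel(3) subsetD)
    then show ?thesis using f1_h1[OF True, of s] f1 by (metis bij_pointE)
  qed (simp add: h1_def)
  define f' where "f' e = h1 (tl e) \<circ> f e \<circ> inv_into UNIV (h1 (butlast e))" for e
  have f'_h1: "f' e (h1 (butlast e) s) = h1 (tl e) (f e s)" if e: "e \<in> F" "length e = Suc (Suc n)" for e s
    using bijh[OF butlast_in[OF e(1)]] e by (simp add: f'_def bij_is_inj)
  have f'_l: "f' e = ?f1" if e: "e \<in> F" "tl e = l @ [b0]" for e
  proof -
    obtain b where eb: "e = b # l @ [b0]" using e by (cases e) auto
    have b: "b # l \<in> F" using e eb appendD1[of "b # l" "[b0]"] by simp
    have "f' e s = ?f1 s" for s
    proof -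
      obtain t where t: "s = h1 (b # l) t"
        using bijh[OF b] l by (metis bij_pointE length_Cons)
      then have "f' e s = h1 (tl e) (f e t)"
        using f'_h1[OF e(1), of t] eb l by (simp add: butlast_append)
      also have "\<dots> = ?f1 s" using f1_h1[of "b # l" t] by (simp add: t eb h1_l)
      finally show ?thesis .
    qed
    then show ?thesis by blast
  qed
  \<comment> \<open>Any left extension may transport the data to order \<open>n\<close>: two choices
    differ only at \<open>l\<close> (for \<open>E''\<close>) or at \<open>l @ [b0]\<close> (for
    \<open>f''\<close>), where \<open>h1\<close> has made the data agree.\<close>
  define \<beta> where "\<beta> v = (SOME b. b # v \<in> F) # v" for v
  have \<beta>: "\<beta> v \<in> F" "tl (\<beta> v) = v" "length (\<beta> v) = Suc (length v)" if "v \<in> F" for v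
    using someI_ex[OF left_extendable[OF that]] by (auto simp: \<beta>_def)
  define f'' where "f'' v = f' (\<beta> v)" for v
  have f'': "f'' (tl e) = f' e" if e: "e \<in> F" "length e = Suc (Suc n)" for e
  proof (cases "\<beta> (tl e) = e")
    case False
    obtain b v where eb: "e = b # v" using e by (cases e) auto
    then have v: "v \<in> F" "length v = Suc n" using e ConsD by auto
    obtain b' where "\<beta> v = b' # v" by (simp add: \<beta>_def)
    then have "v = l @ [b0]" using fib'[OF v(2), of b b'] False \<beta>(1)[OF v(1)] e eb by auto
    then show ?thesis using f'_l[OF e(1)] f'_l[OF \<beta>(1)[OF v(1)]] \<beta>(2)[OF v(1)]
      by (simp add: f''_def eb)
  qed (simp add: f''_def)
  define E'' where "E'' v = h1 (\<beta> v) ` E (\<beta> v)" for v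
  have E'': "E'' (tl w) = h1 w ` E w" if w: "w \<in> F" "length w = Suc n" for w
  proof (cases "\<beta> (tl w) = w")
    case False
    obtain b v where wb: "w = b # v" using w by (cases w) auto
    then have v: "v \<in> F" "length v = n" using w ConsD by auto
    obtain b' where "\<beta> v = b' # v" by (simp add: \<beta>_def)
    then have "v = l" using fib[OF v(2), of b b'] False \<beta>(1)[OF v(1)] w wb by auto
    then show ?thesis using E_h1[OF w] E_h1[of "\<beta> v"] \<beta>[OF v(1)] v wb
      by (simp add: E''_def)
  qed (simp add: E''_def)
  have lift: "\<exists>e\<in>F. length e = Suc (Suc n) \<and> tl e = e'" if "e' \<in> F" "length e' = Suc n" for e'
    using \<beta>[OF that(1)] that(2) by metis
  have tl_butlast: "tl (butlast e) = butlast (tl e)" if "length e = Suc (Suc n)" for e :: "'a list"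
    by (simp add: butlast_tl)
  have last_tl': "last (tl e) = last e" if "length e = Suc (Suc n)" for e :: "'a list"
    using that by (cases e) auto
  have "\<exists>g h E0. (\<forall>a. bij (g a))
    \<and> (\<forall>w\<in>F. length w = n \<longrightarrow> bij (h w) \<and> h w ` E'' w = E0 \<and> (\<forall>s\<in>D []. h w s = s)
          \<and> (\<forall>s\<in>E'' w. \<tau> (h w s) = \<tau> s))
    \<and> (\<forall>e\<in>F. length e = Suc n \<longrightarrow> (\<forall>s. g (last e) (h (butlast e) s) = h (tl e) (f'' e s)))"
  proof (rule Suc.IH)
    fix e' assume e': "e' \<in> F" "length e' = Suc n"
    then obtain e where e: "e \<in> F" "length e = Suc (Suc n)" "tl e = e'" using lift by blast
    have be: "butlast e \<in> F" "length (butlast e) = Suc n" using e butlast_in by auto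
    have f'e: "f'' e' = f' e" using f''[OF e(1,2)] e(3) by simp
    show "bij (f'' e')"
      unfolding f'e f'_def
      using bijh[OF be] bijh[OF e'] bij[OF e(1,2)] e(3)
      by (intro bij_comp) (auto intro: bij_imp_bij_inv)
    have Eb: "E'' (butlast e') = h1 (butlast e) ` E (butlast e)"
      using E''[OF be] tl_butlast[OF e(2)] e(3) by simp
    show "f'' e' ` E'' (butlast e') = E'' (tl e')"
      using E[OF e(1,2)] f'_h1[OF e(1,2)] E''[OF e'] e(3)
      by (simp add: f'e Eb image_image flip: image_image[of "h1 e'" "f e"])
    show "\<tau> (f'' e' s) = act (last e') (\<tau> s)" if s: "s \<in> E'' (butlast e')" for s
    proof -
      obtain t where t: "t \<in> E (butlast e)" "s = h1 (butlast e) t" using s Eb by auto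
      have "f e t \<in> E e'" using E[OF e(1,2)] t(1) e(3) by blast
      then have "\<tau> (f'' e' s) = \<tau> (f e t)"
        using f'_h1[OF e(1,2), of t] t(2) \<tau>_h1(1)[OF e'] e(3) by (simp add: f'e)
      then show ?thesis using \<tau>[OF e(1,2) t(1)] \<tau>_h1(1)[OF be t(1)] t(2) last_tl'[OF e(2)] e(3) by simp
    qed
    show "f'' e' s = k (last e') s" if s: "s \<in> D (butlast e')" "k (last e') s \<in> D (tl e')" for s
    proof -
      have "s \<in> D (tl (butlast e))" using s(1) tl_butlast[OF e(2)] e(3) by simp
      moreover have "D (tl w) \<subseteq> D w" for w using D_Cons by (cases w) auto
      ultimately have h: "h1 (butlast e) s = s" and s': "s \<in> D (butlast e)" "k (last e) s \<in> D (tl e)"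
        using h1_D[OF be] s(2) e last_tl'[OF e(2)] by auto
      have "f'' e' s = h1 e' (f e s)" using f'_h1[OF e(1,2), of s] e(3) by (simp add: f'e h)
      also have "\<dots> = k (last e') s"
        using k[OF e(1,2) s'] h1_D[OF e' s(2)] last_tl'[OF e(2)] e(3) by simp
      finally show ?thesis .
    qed
  next
    fix v s assume v: "v \<in> F" "length v = n" "s \<in> E'' v"
    then obtain t where "t \<in> E (\<beta> v)" "s = h1 (\<beta> v) t" by (auto simp: E''_def)
    then show "\<tau> s \<in> C" using \<tau>_h1(1)[of "\<beta> v" t] C[of "\<beta> v" t] \<beta>[OF v(1)] v(2) by simp
  qed
  then obtain g h E0 where ghE: "(\<forall>a. bij (g a))
    \<and> (\<forall>w\<in>F. length w = n \<longrightarrow> bij (h w) \<and> h w ` E'' w = E0 \<and> (\<forall>s\<in>D []. h w s = s)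
          \<and> (\<forall>s\<in>E'' w. \<tau> (h w s) = \<tau> s))
    \<and> (\<forall>e\<in>F. length e = Suc n \<longrightarrow> (\<forall>s. g (last e) (h (butlast e) s) = h (tl e) (f'' e s)))"
    by (elim exE)
  note g = ghE[THEN conjunct1, rule_format] and h = ghE[THEN conjunct2, THEN conjunct1, rule_format]
    and gh = ghE[THEN conjunct2, THEN conjunct2, rule_format]
  have D_Nil: "D [] \<subseteq> D v" for v
    using D_Cons by (induction v) auto
  show ?case
  proof (intro exI[of _ g] exI[of _ "\<lambda>w. h (tl w) \<circ> h1 w"] exI[of _ E0] conjI allI ballI impI)
    show "bij (g a)" for a by (rule g)
    fix w assume w: "w \<in> F" "length w = Suc n"
    then have tw: "tl w \<in> F" "length (tl w) = n" using tl_in by auto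
    show "bij (h (tl w) \<circ> h1 w)" using h[OF tw] bijh[OF w] by (blast intro: bij_comp)
    show "(h (tl w) \<circ> h1 w) ` E w = E0" using h[OF tw] E''[OF w] by (simp add: image_comp)
    show "(h (tl w) \<circ> h1 w) s = s" if "s \<in> D []" for s
    proof -
      have "s \<in> D (tl w)" using that D_Nil by blast
      then show ?thesis using h[OF tw] h1_D[OF w, of s] that by simp
    qed
    show "\<tau> ((h (tl w) \<circ> h1 w) s) = \<tau> s" if "s \<in> E w" for s
    proof -
      have "h1 w s \<in> E'' (tl w)" using that E''[OF w] by blast
      then show ?thesis using h[OF tw] \<tau>_h1(1)[OF w that] by simp
    qed
  next
    fix e s assume e: "e \<in> F" "length e = Suc (Suc n)"
    have te: "tl e \<in> F" "length (tl e) = Suc n" using e tl_in by auto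
    show "g (last e) ((h (tl (butlast e)) \<circ> h1 (butlast e)) s) = (h (tl (tl e)) \<circ> h1 (tl e)) (f e s)"
      using gh[OF te, of "h1 (butlast e) s"] f'_h1[OF e, of s] f''[OF e]
        last_tl'[OF e(2)] tl_butlast[OF e(2)] by simp
  qed
qed

end

section \<open>From strict episturmian words to the axioms of the language\<close>

lemma factors_iff: "w \<in> factors x \<longleftrightarrow> (\<exists>i. w = map x [i..<i + length w])"
proof
  assume "w \<in> factors x"
  then obtain i n where "w = map x [i..<i + n]" by (auto simp: factors_def)
  then show "\<exists>i. w = map x [i..<i + length w]" by (intro exI[of _ i]) simp
qed (auto simp: factors_def)

lemma map_upt_append: "i \<le> j \<Longrightarrow> j \<le> m \<Longrightarrow> map x [i..<m] = map x [i..<j] @ map x [j..<m]"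
  using upt_add_eq_append[of i j "m - j"] by simp

text \<open>Closure under reversal makes a one-sided infinite word recurrent; the second of two
  factors can thus be found beyond the first.\<close>

lemma occurs_late:
  assumes rev: "\<forall>w\<in>factors x. rev w \<in> factors x" and w: "w \<in> factors x"
  shows "\<exists>i\<ge>N. w = map x [i..<i + length w]"
proof -
  txt \<open>The reversal of a long prefix occurs somewhere, and carries \<open>rev w\<close> far from its start.\<close>
  have late: "\<exists>i\<ge>N. rev w = map x [i..<i + length w]" if w: "w \<in> factors x" for w
  proof -
    obtain i where i: "w = map x [i..<i + length w]" using w factors_iff by blast
    \<comment> \<open>The \<open>N\<close> letters kept after \<open>w\<close> become, once
      reversed, the \<open>N\<close> letters before \<open>rev w\<close>.\<close>
    let ?m = "i + length w + N"
    have "map x [0..<0 + ?m] \<in> factors x" unfolding factors_def by blast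
    then have "map x [0..<?m] \<in> factors x" by simp
    then have "rev (map x [0..<?m]) \<in> factors x" using rev by blast
    then obtain j where j: "rev (map x [0..<?m]) = map x [j..<j + ?m]"
      by (auto simp: factors_iff)
    have pre: "map x [0..<?m] = map x [0..<i] @ w @ map x [i + length w..<?m]"
      using map_upt_append[of 0 i ?m x] map_upt_append[of i "i + length w" ?m x] i by simp
    have "map x [j..<j + ?m] = map x [j..<j + N] @ map x [j + N..<j + N + length w] @ map x [j + N + length w..<j + ?m]"
      using map_upt_append[of j "j + N" "j + ?m" x] map_upt_append[of "j + N" "j + N + length w" "j + ?m" x] by simp
    then have "rev (map x [i + length w..<?m]) @ rev w @ rev (map x [0..<i]) =
      map x [j..<j + N] @ map x [j + N..<j + N + length w] @ map x [j + N + length w..<j + ?m]"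
      using j pre by simp
    then have "rev w = map x [j + N..<j + N + length w]"
      by (subst (asm) append_eq_append_conv) (auto simp: append_eq_append_conv)
    then show ?thesis by (intro exI[of _ "j + N"]) simp
  qed
  show ?thesis using late[of "rev w"] rev w by simp
qed

lemma sturmian_set_language:
  assumes "sturmian_set A F"
  shows "sturmian_language A F"
proof -
  obtain x where x: "strict_episturmian A x" and F: "F = factors x"
    using assms by (auto simp: sturmian_set_def)
  have xA: "x i \<in> A" for i using x by (simp add: strict_episturmian_def episturmian_def)
  have rev: "rev w \<in> F" if "w \<in> F" for w
    using x that by (simp add: strict_episturmian_def episturmian_def F)
  have let': "set w \<subseteq> A" if "w \<in> F" for w
    using that xA by (auto simp: F factors_def)
  have fact: "v \<in> F" if "u @ v @ w \<in> F" for u v w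
  proof -
    obtain i where i: "u @ v @ w = map x [i..<i + length (u @ v @ w)]" using \<open>u @ v @ w \<in> F\<close> factors_iff F by blast
    have "map x [i..<i + length (u @ v @ w)] = map x [i..<i + length u] @
      map x [i + length u..<i + length u + length v] @ map x [i + length u + length v..<i + length (u @ v @ w)]"
      using map_upt_append[of i "i + length u" "i + length (u @ v @ w)" x]
        map_upt_append[of "i + length u" "i + length u + length v" "i + length (u @ v @ w)" x] by simp
    with i have "u @ v @ w = map x [i..<i + length u] @
      map x [i + length u..<i + length u + length v] @ map x [i + length u + length v..<i + length (u @ v @ w)]"
      by (rule trans)
    then have "v = map x [i + length u..<i + length u + length v]"
      by (subst (asm) append_eq_append_conv) (auto simp: append_eq_append_conv)
    then show ?thesis using F factors_iff by blast
  qed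
  show ?thesis
  proof
    show "set w \<subseteq> A" if "w \<in> F" for w using let' that .
    show "v \<in> F" if "u @ v @ w \<in> F" for u v w using fact that .
    show "\<exists>z. u @ z @ v \<in> F" if u: "u \<in> F" and v: "v \<in> F" for u v
    proof -
      obtain i where i: "u = map x [i..<i + length u]" using u F factors_iff by blast
      obtain j where j: "i + length u \<le> j" "v = map x [j..<j + length v]"
        using occurs_late[of x v "i + length u"] rev v F by blast
      have "map x [i..<j + length v] = map x [i..<i + length u] @ map x [i + length u..<j] @ map x [j..<j + length v]"
        using map_upt_append[of i "i + length u" "j + length v" x] map_upt_append[of "i + length u" j "j + length v" x] j(1) by simp
      then have "u @ map x [i + length u..<j] @ v = map x [i..<j + length v]"
        using i j(2) by simp
      moreover have "map x [i..<j + length v] \<in> F" unfolding F factors_def using j(1)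
        by (intro CollectI exI[of _ i] exI[of _ "j + length v - i"]) simp
      ultimately show ?thesis by metis
    qed
    show "\<exists>a\<in>A. \<exists>b\<in>A. a \<noteq> b"
      using x unfolding strict_episturmian_def right_special_def by blast
    show "\<exists>l. length l = n \<and> (\<forall>a\<in>A. a # l \<in> F) \<and>
      (\<forall>v a b. length v = n \<and> a # v \<in> F \<and> b # v \<in> F \<and> a \<noteq> b \<longrightarrow> v = l)" for n
    proof -
      obtain r where r: "right_special A F r" "length r = n"
        and uniq: "\<And>u. right_special A F u \<Longrightarrow> length u = n \<Longrightarrow> u = r"
        using x unfolding strict_episturmian_def F by metis
      have ext: "r @ [a] \<in> F" if "a \<in> A" for a
        using x r(1) that by (simp add: strict_episturmian_def F)
      \<comment> \<open>Reversal exchanges right-special and left-special words.\<close>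
      show ?thesis
      proof (intro exI[of _ "rev r"] conjI ballI allI impI)
        show "a # rev r \<in> F" if "a \<in> A" for a using rev[OF ext[OF that]] by simp
        fix v a b assume v: "length v = n \<and> a # v \<in> F \<and> b # v \<in> F \<and> a \<noteq> b"
        have "right_special A F (rev v)"
          unfolding right_special_def
        proof (intro conjI bexI)
          show "rev v \<in> F" using rev fact[of "[a]" v "[]"] v by simp
          show "rev v @ [a] \<in> F" "rev v @ [b] \<in> F" using rev[of "a # v"] rev[of "b # v"] v by auto
          show "a \<in> A" "b \<in> A" using v let'[of "a # v"] let'[of "b # v"] by auto
        qed (use v in simp)
        then show "v = rev r" using uniq[of "rev v"] v by auto
      qed (use r in simp)
    qed
  qed
qed

section \<open>Bifix codes in a Sturmian language\<close>

text \<open>\<open>D\<close> and its image have the same size, so their complements in the finite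
  union can be matched; the identity serves elsewhere.\<close>

lemma ex_bij_extending:
  fixes \<phi> :: "'b \<Rightarrow> 'b"
  assumes "finite D" "inj_on \<phi> D"
  shows "\<exists>\<pi>. bij \<pi> \<and> (\<forall>u\<in>D. \<pi> u = \<phi> u)"
proof -
  let ?U = "D \<union> \<phi> ` D"
  have "card (?U - D) = card (?U - \<phi> ` D)"
    using assms by (simp add: card_Diff_subset card_image)
  then obtain \<psi> where \<psi>: "bij_betw \<psi> (?U - D) (?U - \<phi> ` D)"
    using finite_same_card_bij[of "?U - D" "?U - \<phi> ` D"] assms(1) by auto
  let ?\<pi> = "\<lambda>u. if u \<in> D then \<phi> u else if u \<in> ?U then \<psi> u else u"
  have 1: "bij_betw ?\<pi> D (\<phi> ` D)"
    using assms(2) bij_betw_cong[of D ?\<pi> \<phi>] by (simp add: inj_on_imp_bij_betw)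
  have 2: "bij_betw ?\<pi> (?U - D) (?U - \<phi> ` D)"
    using \<psi> by (subst bij_betw_cong[of _ _ \<psi>]) auto
  have 3: "bij_betw ?\<pi> (- ?U) (- ?U)"
    by (subst bij_betw_cong[of _ _ id]) auto
  have "bij_betw ?\<pi> (D \<union> (?U - D) \<union> - ?U) (\<phi> ` D \<union> (?U - \<phi> ` D) \<union> - ?U)"
    by (intro bij_betw_combine 1 2 3) auto
  moreover have "D \<union> (?U - D) \<union> - ?U = UNIV" "\<phi> ` D \<union> (?U - \<phi> ` D) \<union> - ?U = UNIV" by auto
  ultimately show ?thesis by (intro exI[of _ ?\<pi>]) simp
qed

section \<open>States over a word and the reading of letters\<close>

definition no_prefix :: "'a list set \<Rightarrow> 'a list \<Rightarrow> bool" where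
  "no_prefix X u \<longleftrightarrow> (\<forall>p. prefix p u \<longrightarrow> p \<notin> X)"

text \<open>The states over \<open>w\<close>: the possible right parts of a parse of
  \<open>w\<close>.\<close>

definition ends :: "'a list set \<Rightarrow> 'a list \<Rightarrow> 'a list set" where
  "ends X w = {u. suffix u w \<and> no_prefix X u}"

lemma finite_ends: "finite (ends X w)"
  by (rule finite_subset[of _ "set (suffixes w)"]) (auto simp: ends_def)

lemma Nil_in_word_star: "[] \<in> word_star X"
  by (auto simp: word_star_def intro: exI[of _ "[]"])

lemma in_word_star: "x \<in> X \<Longrightarrow> x \<in> word_star X"
  by (auto simp: word_star_def intro: exI[of _ "[x]"])

lemma append_word_star: "x \<in> word_star X \<Longrightarrow> y \<in> word_star X \<Longrightarrow> x @ y \<in> word_star X"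
  unfolding word_star_def by clarify (metis concat_append set_append Un_least)

lemma word_star_ConsE:
  assumes "w \<in> word_star X" "w \<noteq> []" "[] \<notin> X"
  obtains x where "x \<in> X" "prefix x w"
proof -
  obtain ws where ws: "w = concat ws" "set ws \<subseteq> X" using assms by (auto simp: word_star_def)
  with assms(2) obtain x xs where "ws = x # xs" by (cases ws) auto
  then show ?thesis using ws that[of x] by auto
qed

lemma bifix_code_prefix: "bifix_code X \<Longrightarrow> x \<in> X \<Longrightarrow> y \<in> X \<Longrightarrow> prefix x y \<Longrightarrow> x = y"
  by (auto simp: bifix_code_def strict_prefix_def)

lemma bifix_code_suffix: "bifix_code X \<Longrightarrow> x \<in> X \<Longrightarrow> y \<in> X \<Longrightarrow> suffix x y \<Longrightarrow> x = y"
  by (auto simp: bifix_code_def strict_suffix_def)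

lemma bifix_code_suffixes:
  "bifix_code X \<Longrightarrow> x \<in> X \<Longrightarrow> y \<in> X \<Longrightarrow> suffix x w \<Longrightarrow> suffix y w \<Longrightarrow> x = y"
  using suffix_same_cases[of x w y] bifix_code_suffix by metis

lemma bifix_code_no_prefix_butlast:
  assumes "bifix_code X" "u @ [a] \<in> X"
  shows "no_prefix X u"
  unfolding no_prefix_def
proof (intro allI impI notI)
  fix p assume "prefix p u" "p \<in> X"
  then show False using bifix_code_prefix[OF assms(1), of p "u @ [a]"] assms(2)
    by (auto simp: prefix_def)
qed

lemma no_prefix_snoc: "no_prefix X (u @ [a]) \<longleftrightarrow> no_prefix X u \<and> u @ [a] \<notin> X"
  by (auto simp: no_prefix_def)

lemma no_prefix_Nil: "bifix_code X \<Longrightarrow> no_prefix X []"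
  by (auto simp: no_prefix_def bifix_code_def)

lemma ends_Nil: "bifix_code X \<Longrightarrow> ends X [] = {[]}"
  by (auto simp: ends_def no_prefix_Nil)

text \<open>Reading a letter: \<open>u\<close> is the part of the input read since the last complete word of \<open>X\<close>;
  completing \<open>x \<in> X\<close> applies \<open>c x\<close> to the second component.\<close>

definition read_letter :: "'a list set \<Rightarrow> ('a list \<Rightarrow> 'z \<Rightarrow> 'z) \<Rightarrow> 'a \<Rightarrow> 'a list \<times> 'z \<Rightarrow> 'a list \<times> 'z" where
  "read_letter X c a s = (if fst s @ [a] \<in> X then ([], c (fst s @ [a]) (snd s)) else (fst s @ [a], snd s))"

lemma fold_read_letter_no_prefix:
  "no_prefix X u \<Longrightarrow> fold (read_letter X c) u ([], z) = (u, z)"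
  by (induction u rule: rev_induct) (auto simp: no_prefix_snoc read_letter_def)

lemma fold_read_letter_code:
  assumes "bifix_code X" "x \<in> X"
  shows "fold (read_letter X c) x ([], z) = ([], c x z)"
proof (cases x rule: rev_cases)
  case Nil
  then have "[] \<in> X" using assms(2) by simp
  then show ?thesis using assms(1) unfolding bifix_code_def by blast
next
  case (snoc u a)
  then show ?thesis
    using assms fold_read_letter_no_prefix[OF bifix_code_no_prefix_butlast, of X u a c z]
    by (simp add: read_letter_def)
qed

text \<open>Reading discards complete code words only, so a return to the empty state exhibits a
  factorisation over \<open>X\<close>.\<close>

lemma fold_read_letter_word_star:
  "\<exists>x\<in>word_star X. w = x @ fst (fold (read_letter X c) w ([], z))"
proof (induction w rule: rev_induct)
  case Nil
  then show ?case by (auto intro: Nil_in_word_star)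
next
  case (snoc a w)
  define s where "s = fold (read_letter X c) w ([], z)"
  obtain x where x: "x \<in> word_star X" "w = x @ fst s" using snoc unfolding s_def by blast
  have fold: "fold (read_letter X c) (w @ [a]) ([], z) = read_letter X c a s" by (simp add: s_def)
  show ?case
  proof (cases "fst s @ [a] \<in> X")
    case True
    then have "x @ fst s @ [a] \<in> word_star X" using x(1) append_word_star in_word_star by blast
    then show ?thesis unfolding fold using True x(2) by (simp add: read_letter_def)
  next
    case False
    then show ?thesis unfolding fold using x by (auto simp: read_letter_def)
  qed
qed

section \<open>Permutations attached to a bifix code\<close>

locale bifix_in_sturmian = sturmian_language A F for A :: "'a set" and F +
  fixes X :: "'a list set"
  assumes bifix: "bifix_code X" and XF: "X \<subseteq> F"
begin

text \<open>On the words of length \<open>n\<close>, the partial reading of letters is injective because \<open>X\<close> is a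
  suffix code, hence extends to permutations of the edges of the Rauzy graph.\<close>

lemma covering:
  fixes c :: "'a list \<Rightarrow> 'z \<Rightarrow> 'z" and E :: "'a list \<Rightarrow> ('a list \<times> 'z) set"
  assumes c: "\<And>x. bij (c x)"
    and E_ends: "\<And>w. E w \<subseteq> ends X w \<times> UNIV"
    and E: "\<And>e. e \<in> F \<Longrightarrow> length e = Suc n \<Longrightarrow> read_letter X c (last e) ` E (butlast e) = E (tl e)"
    and C: "\<And>w s. w \<in> F \<Longrightarrow> length w = n \<Longrightarrow> s \<in> E w \<Longrightarrow> \<tau> s \<in> C"
    and \<tau>: "\<And>e s. e \<in> F \<Longrightarrow> length e = Suc n \<Longrightarrow> s \<in> E (butlast e) \<Longrightarrow>
      \<tau> (read_letter X c (last e) s) = act (last e) (\<tau> s)"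
    and act: "\<And>a. a \<in> A \<Longrightarrow> inj_on (act a) C"
  shows "\<exists>g h E0. (\<forall>a. bij (g a))
    \<and> (\<forall>w\<in>F. length w = n \<longrightarrow> bij (h w) \<and> h w ` E w = E0 \<and> (\<forall>z. h w ([], z) = ([], z))
          \<and> (\<forall>s\<in>E w. \<tau> (h w s) = \<tau> s))
    \<and> (\<forall>e\<in>F. length e = Suc n \<longrightarrow> (\<forall>s\<in>E (butlast e).
          g (last e) (h (butlast e) s) = h (tl e) (read_letter X c (last e) s)))
    \<and> (\<forall>y w z. length y = n \<and> y @ w \<in> F \<and> length w \<le> n \<longrightarrow>
          fold g w ([], z) = h (drop (length w) (y @ w)) (fold (read_letter X c) w ([], z)))"
proof -
  let ?k = "read_letter X c"
  define \<phi> where "\<phi> a u = (if u @ [a] \<in> X then [] else u @ [a])" for a u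
  \<comment> \<open>The only state over \<open>butlast e\<close> that can be left out is that whole
    word, when the letter does not complete a code word: the longer word no longer fits into
    \<open>tl e\<close>.\<close>
  define Dom where "Dom e = {u \<in> ends X (butlast e). \<phi> (last e) u \<in> ends X (tl e)}" for e
  have "inj_on (\<phi> (last e)) (Dom e)" for e
  proof (rule inj_onI)
    fix u v assume uv: "u \<in> Dom e" "v \<in> Dom e" "\<phi> (last e) u = \<phi> (last e) v"
    have e: "u @ [last e] \<in> X \<Longrightarrow> v @ [last e] \<in> X \<Longrightarrow> u = v"
    proof -
      assume "u @ [last e] \<in> X" "v @ [last e] \<in> X"
      moreover have "suffix (u @ [last e]) (butlast e @ [last e])" "suffix (v @ [last e]) (butlast e @ [last e])"
        using uv by (auto simp: Dom_def ends_def)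
      ultimately show "u = v" using bifix_code_suffixes[OF bifix] by blast
    qed
    then show "u = v" using uv(3) by (auto simp: \<phi>_def split: if_splits)
  qed
  moreover have "finite (Dom e)" for e unfolding Dom_def by (rule finite_subset[OF _ finite_ends]) auto
  ultimately have "\<exists>\<pi>. bij \<pi> \<and> (\<forall>u\<in>Dom e. \<pi> u = \<phi> (last e) u)" for e
    by (intro ex_bij_extending)
  then obtain \<pi> where \<pi>: "\<And>e. bij (\<pi> e)" "\<And>e u. u \<in> Dom e \<Longrightarrow> \<pi> e u = \<phi> (last e) u" by metis
  \<comment> \<open>The second component is changed by a bijection chosen by the first one alone, so
    \<open>f e\<close> is bijective along with \<open>\<pi> e\<close>.\<close>
  define f where "f e s = (\<pi> e (fst s), (if fst s @ [last e] \<in> X then c (fst s @ [last e]) (snd s) else snd s))" for e s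
  define D where "D w = ends X w \<times> (UNIV :: 'z set)" for w
  have f_bij: "bij (f e)" for e
  proof (rule bijI)
    show "inj (f e)"
    proof (rule injI)
      fix s t assume st: "f e s = f e t"
      then have fst: "fst s = fst t" using bij_is_inj[OF \<pi>(1)[of e]] by (auto simp: f_def dest: injD)
      have "snd s = snd t"
        using st fst injD[OF bij_is_inj[OF c[of "fst t @ [last e]"]], of "snd s" "snd t"]
        by (simp add: f_def split: if_splits)
      then show "s = t" using fst by (simp add: prod_eq_iff)
    qed
    show "surj (f e)"
      unfolding surj_def
    proof
      fix t :: "'a list \<times> 'z"
      obtain u where u: "fst t = \<pi> e u" using \<pi>(1)[of e] by (metis bij_pointE)
      have "\<exists>z. snd t = (if u @ [last e] \<in> X then c (u @ [last e]) z else z)"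
        using c[of "u @ [last e]"] by (metis bij_pointE)
      then obtain z where "snd t = (if u @ [last e] \<in> X then c (u @ [last e]) z else z)" by blast
      then show "\<exists>s. t = f e s" using u by (intro exI[of _ "(u, z)"]) (simp add: f_def prod_eq_iff)
    qed
  qed
  have f_k: "f e s = ?k (last e) s" if "s \<in> D (butlast e)" "?k (last e) s \<in> D (tl e)" for e s
  proof -
    have "fst s \<in> Dom e" using that by (auto simp: Dom_def D_def read_letter_def \<phi>_def split: if_splits)
    then show ?thesis using \<pi>(2)[of "fst s" e] by (auto simp: f_def read_letter_def \<phi>_def)
  qed
  have ED: "E w \<subseteq> D w" for w using E_ends by (simp add: D_def)
  have f_E: "f e s = ?k (last e) s" if "e \<in> F" "length e = Suc n" "s \<in> E (butlast e)" for e s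
    using f_k[of s e] E[OF that(1,2)] that(3) ED by blast
  have D_Cons: "D v \<subseteq> D (b # v)" for b v
    by (auto simp: D_def ends_def suffix_ConsI)
  have D_suffix: "D v \<subseteq> D w" if "suffix v w" for v w
    using that by (auto simp: D_def ends_def intro: suffix_order.trans)
  have D_snoc: "?k a s \<in> D (v @ [a])" if "s \<in> D v" for v s a
    using that by (auto simp: D_def ends_def read_letter_def no_prefix_snoc no_prefix_Nil[OF bifix])
  have "\<exists>g h E0. (\<forall>a. bij (g a))
    \<and> (\<forall>w\<in>F. length w = n \<longrightarrow> bij (h w) \<and> h w ` E w = E0 \<and> (\<forall>s\<in>D []. h w s = s)
          \<and> (\<forall>s\<in>E w. \<tau> (h w s) = \<tau> s))
    \<and> (\<forall>e\<in>F. length e = Suc n \<longrightarrow> (\<forall>s. g (last e) (h (butlast e) s) = h (tl e) (f e s)))"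
  proof (rule rauzy_gauge[where C = C and act = act and k = ?k])
    show "f e ` E (butlast e) = E (tl e)" if "e \<in> F" "length e = Suc n" for e
      using E[OF that] f_E[OF that] by (metis image_cong)
    show "\<tau> (f e s) = act (last e) (\<tau> s)" if "e \<in> F" "length e = Suc n" "s \<in> E (butlast e)" for e s
      using \<tau>[OF that] f_E[OF that] by simp
  qed (use f_bij f_k C D_Cons D_snoc act in blast)+
  then obtain g h E0 where ghE: "(\<forall>a. bij (g a))
    \<and> (\<forall>w\<in>F. length w = n \<longrightarrow> bij (h w) \<and> h w ` E w = E0 \<and> (\<forall>s\<in>D []. h w s = s)
          \<and> (\<forall>s\<in>E w. \<tau> (h w s) = \<tau> s))
    \<and> (\<forall>e\<in>F. length e = Suc n \<longrightarrow> (\<forall>s. g (last e) (h (butlast e) s) = h (tl e) (f e s)))"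
    by (elim exE)
  note g = ghE[THEN conjunct1, rule_format] and h = ghE[THEN conjunct2, THEN conjunct1, rule_format]
    and gh = ghE[THEN conjunct2, THEN conjunct2, rule_format]
  have h_Nil: "h w ([], z) = ([], z)" if "w \<in> F" "length w = n" for w z
    using h[OF that] by (simp add: D_def ends_Nil[OF bifix])
  \<comment> \<open>The context \<open>y\<close> makes every stage a full vertex. The state is a
    suffix of \<open>w\<close>, and \<open>length w \<le> n\<close> keeps it inside the current
    vertex, where \<open>f\<close> is the true reading map.\<close>
  have path: "fold ?k w ([], z) \<in> D w \<and> fold g w ([], z) = h (drop (length w) (y @ w)) (fold ?k w ([], z))"
    if "length y = n" "y @ w \<in> F" "length w \<le> n" for y w z
    using that(2,3)
  proof (induction w rule: rev_induct)
    case Nil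
    then show ?case using h_Nil that(1) by (simp add: D_def ends_Nil[OF bifix])
  next
    case (snoc a w)
    have IH: "fold ?k w ([], z) \<in> D w" "fold g w ([], z) = h (drop (length w) (y @ w)) (fold ?k w ([], z))"
      using snoc.IH snoc.prems appendD1[of "y @ w" "[a]"] by auto
    let ?s = "fold ?k w ([], z)"
    let ?e = "drop (length w) (y @ w @ [a])"
    have e: "?e = drop (length w) (y @ w) @ [a]" by simp
    have eF: "?e \<in> F" "length ?e = Suc n"
      using drop_in[OF snoc.prems(1), of "length w"] that(1) by (simp_all del: drop_append)
    have tl: "tl ?e = drop (length (w @ [a])) (y @ w @ [a])" by (simp add: tl_drop drop_Suc del: drop_append)
    have "suffix w (drop (length w) (y @ w))"
      using snoc.prems(2) that(1) by (auto simp: suffix_def)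
    then have s: "?s \<in> D (butlast ?e)" using IH(1) D_suffix by (auto simp: e simp del: drop_append)
    have "suffix (w @ [a]) (tl ?e)"
      using snoc.prems(2) that(1) unfolding tl by (auto simp: suffix_def)
    then have ks: "?k a ?s \<in> D (tl ?e)" using D_snoc[OF IH(1), of a] D_suffix by blast
    have "f ?e ?s = ?k a ?s" using f_k[OF s] ks by (simp add: e del: drop_append)
    then have "g a (h (butlast ?e) ?s) = h (tl ?e) (?k a ?s)"
      using gh[OF eF, of ?s] by (simp add: e del: drop_append)
    then have "fold g (w @ [a]) ([], z) = h (drop (length (w @ [a])) (y @ w @ [a])) (fold ?k (w @ [a]) ([], z))"
      using IH(2) unfolding tl by (simp add: e butlast_append del: drop_append)
    then show ?case using D_snoc[OF IH(1), of a] by simp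
  qed
  show ?thesis
  proof (intro exI[of _ g] exI[of _ h] exI[of _ E0] conjI allI ballI impI)
    show "g (last e) (h (butlast e) s) = h (tl e) (?k (last e) s)"
      if "e \<in> F" "length e = Suc n" "s \<in> E (butlast e)" for e s
      using gh[OF that(1,2), of s] f_E[OF that] by simp
  qed (use g h h_Nil path in blast)+
qed

lemma code_carrier: "embed_word ` X \<subseteq> carrier (free_group A)"
  using XF letters by (auto intro!: embed_word_carrier)

text \<open>Vertices are taken at least as long as \<open>m\<close> and as every code word, so that
  whole words are read faithfully. Since \<open>h\<close> is injective and fixes all
  \<open>([], z)\<close>, a return to an empty state under \<open>g\<close> is a return of the
  reading itself.\<close>

lemma code_permutations:
  fixes c :: "'a list \<Rightarrow> 'z \<Rightarrow> 'z"
  assumes c: "\<And>x. bij (c x)" and fin: "finite X"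
  shows "\<exists>g :: 'a \<Rightarrow> 'a list \<times> 'z \<Rightarrow> 'a list \<times> 'z. (\<forall>a. bij (g a)) \<and> (\<forall>x\<in>X. \<forall>z. fold g x ([], z) = ([], c x z))
    \<and> (\<forall>w z z'. w \<in> F \<and> length w \<le> m \<and> fold g w ([], z) = ([], z') \<longrightarrow> w \<in> word_star X)"
proof -
  let ?k = "read_letter X c"
  obtain n where n: "m \<le> n" "\<And>x. x \<in> X \<Longrightarrow> length x \<le> n"
    using fin by (metis finite_imageI finite_nat_set_iff_bounded_le imageI nat_le_linear order_trans)
  obtain g :: "'a \<Rightarrow> 'a list \<times> 'z \<Rightarrow> 'a list \<times> 'z" and h where g: "\<And>a. bij (g a)"
    and h: "\<And>w. w \<in> F \<Longrightarrow> length w = n \<Longrightarrow> bij (h w) \<and> (\<forall>z. h w ([], z) = ([], z))"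
    and path: "\<And>y w z. length y = n \<Longrightarrow> y @ w \<in> F \<Longrightarrow> length w \<le> n \<Longrightarrow>
       fold g w ([], z) = h (drop (length w) (y @ w)) (fold ?k w ([], z))"
    using covering[of c "\<lambda>_. {}" n "\<lambda>_. ()" UNIV "\<lambda>_. id", OF c] by clarsimp blast
  have path': "\<exists>v\<in>F. length v = n \<and> fold g w ([], z) = h v (fold ?k w ([], z))"
    if w: "w \<in> F" "length w \<le> n" for w z
  proof -
    obtain y where y: "length y = n" "y @ w \<in> F" using left_extendable_length[OF w(1)] by blast
    let ?v = "drop (length w) (y @ w)"
    have "?v \<in> F" using y(2) by (rule drop_in)
    moreover have "length ?v = n" using y by simp
    ultimately show ?thesis using path[OF y w(2)] by blast
  qed
  show ?thesis
  proof (intro exI[of _ g] conjI allI ballI impI)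
    show "bij (g a)" for a by (rule g)
    show "fold g x ([], z) = ([], c x z)" if x: "x \<in> X" for x z
    proof -
      obtain v where "v \<in> F" "length v = n" "fold g x ([], z) = h v (fold ?k x ([], z))"
        using path'[of x z] XF x n(2)[OF x] by blast
      then show ?thesis using h fold_read_letter_code[OF bifix x, of c z] by simp
    qed
    fix w z z' assume w: "w \<in> F \<and> length w \<le> m \<and> fold g w ([], z) = ([], z')"
    then obtain v where v: "v \<in> F" "length v = n" "h v (fold ?k w ([], z)) = ([], z')"
      using path'[of w z] n(1) by force
    then have "h v (fold ?k w ([], z)) = h v ([], z')" using h by simp
    then have "fold ?k w ([], z) = ([], z')" using h[OF v(1,2)] by (metis bij_pointE)
    then show "w \<in> word_star X" using fold_read_letter_word_star[of X w c z] by auto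
  qed
qed

text \<open>The subgroup fixes the base state, and for a factor fixing the base state means
  factoring into code words.\<close>

lemma saturation:
  assumes "finite X" "w \<in> F" "embed_word w \<in> generate (free_group A) (embed_word ` X)"
  shows "w \<in> word_star X"
proof -
  obtain g :: "'a \<Rightarrow> 'a list \<times> unit \<Rightarrow> 'a list \<times> unit" where g: "\<And>a. bij (g a)"
    and X: "\<And>x. x \<in> X \<Longrightarrow> fold g x ([], ()) = ([], ())"
    and w: "\<And>v. v \<in> F \<Longrightarrow> length v \<le> length w \<Longrightarrow> fold g v ([], ()) = ([], ()) \<Longrightarrow> v \<in> word_star X"
    using code_permutations[of "\<lambda>_. id" "length w", OF _ assms(1)] by clarsimp blast
  have "word_perm g (embed_word w) ([], ()) = ([], ())"
  proof (rule word_perm_generate_fixes[OF g code_carrier _ assms(3)])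
    show "word_perm g y ([], ()) = ([], ())" if "y \<in> embed_word ` X" for y
      using that X by (auto simp: word_perm_embed_word)
  qed
  then show ?thesis using w[OF assms(2)] by (simp add: word_perm_embed_word)
qed

end

section \<open>Freeness of finite bifix codes\<close>

lemma reduced_iff_successively: "reduced w \<longleftrightarrow> successively (\<lambda>p q. \<not> cancels p q) w"
  by (induction w rule: reduced.induct) auto

lemma reduced_rev:
  fixes w :: "('b \<times> bool) list"
  shows "reduced (rev w) \<longleftrightarrow> reduced w"
proof -
  have "(\<lambda>p q :: 'b \<times> bool. \<not> cancels q p) = (\<lambda>p q. \<not> cancels p q)"
    by (auto simp: cancels_def fun_eq_iff)
  from arg_cong[OF this, of "\<lambda>P. successively P w"] show ?thesis
    unfolding reduced_iff_successively successively_rev .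
qed

text \<open>Nothing cancels, so the stack keeps the whole word with its last letter on top.\<close>

lemma fold_push_reduced: "reduced w \<Longrightarrow> fold push w [] = rev w"
proof (induction w rule: rev_induct)
  case (snoc p w)
  then have "reduced (p # rev w)" using reduced_rev[of "w @ [p]"] by simp
  then show ?case using snoc.IH reduced_rev[of w] by (simp add: push_eq_Cons reduced_ConsD)
qed simp

context bifix_in_sturmian
begin

text \<open>Freeness: reading the words of \<open>X\<close> performs the corresponding stack operations, so a reduced
  product of them is recorded on the stack.\<close>

lemma finite_code_free:
  assumes fin: "finite X" and ws: "set (map fst ws) \<subseteq> embed_word ` X" "reduced ws" "ws \<noteq> []"
  shows "eval_word (free_group A) ws \<noteq> []"
proof
  let ?G = "free_group A"
  interpret group ?G by (rule group_free_group)
  assume ev: "eval_word ?G ws = []"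
  \<comment> \<open>Stacks that are not reduced stay fixed, because \<open>c x\<close> has to be a
    bijection of the whole type.\<close>
  define c where "c x z = (if reduced z then push (x, False) z else z)" for x and z :: "('a list \<times> bool) list"
  have pp: "push (x, b) (push (x, \<not> b) z) = z" if "reduced z" for x :: "'a list" and b z
    using that by (intro push_push_cancel) (auto simp: cancels_def)
  have c_bij: "bij (c x)" for x
  proof (rule o_bij)
    show "(\<lambda>z. if reduced z then push (x, True) z else z) \<circ> c x = id"
      using pp[of _ x True] by (auto simp: c_def fun_eq_iff reduced_push)
    show "c x \<circ> (\<lambda>z. if reduced z then push (x, True) z else z) = id"
      using pp[of _ x False] by (auto simp: c_def fun_eq_iff reduced_push)
  qed
  obtain g :: "'a \<Rightarrow> 'a list \<times> ('a list \<times> bool) list \<Rightarrow> _"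
    where g: "\<And>a. bij (g a)" and gX: "\<And>x z. x \<in> X \<Longrightarrow> fold g x ([], z) = ([], c x z)"
    using code_permutations[of c 0, OF c_bij fin] by blast
  \<comment> \<open>The same product, written with the code words themselves as letters of the stack
    alphabet.\<close>
  define vs where "vs = map (map_prod (inv_into UNIV embed_word) id) ws"
  have vs: "fst p \<in> X" if "p \<in> set vs" for p
    using that ws(1) by (auto simp: vs_def inv_f_f[OF inj_embed_word])
  have ws_vs: "ws = map (map_prod embed_word id) vs"
    using ws(1) by (auto simp: vs_def intro!: map_idI[symmetric] simp: inv_f_f[OF inj_embed_word] map_prod_def)
  have red: "reduced vs"
    using ws(2) unfolding ws_vs reduced_iff_successively successively_map
    by (rule successively_mono) (auto simp: cancels_def)
  have "word_perm g (eval_word ?G (map (map_prod embed_word id) us)) ([], z) = ([], fold push us z)"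
    if "set us \<subseteq> set vs" "reduced z" for us z
    using that
  proof (induction us arbitrary: z)
    case Nil
    then show ?case by (simp add: word_perm_def)
  next
    case (Cons p us)
    obtain x b where p: "p = (x, b)" by force
    have x: "x \<in> X" using vs[of p] Cons.prems p by auto
    let ?y = "if b then inv\<^bsub>?G\<^esub> (embed_word x) else embed_word x"
    have step: "word_perm g ?y ([], z) = ([], push p z)"
    proof (cases b)
      case True
      have "word_perm g (embed_word x) ([], push p z) = ([], z)"
        using gX[OF x, of "push p z"] pp[of z x False] Cons.prems(2) True
        by (simp add: word_perm_embed_word c_def p reduced_push)
      then show ?thesis
        using word_perm_inv[of g "embed_word x" A "([], push p z)", OF g] code_carrier x True by auto
    next
      case False
      then show ?thesis using gX[OF x, of z] Cons.prems(2) by (simp add: word_perm_embed_word c_def p)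
    qed
    have "eval_word ?G (map (map_prod embed_word id) (p # us)) =
      ?y \<otimes>\<^bsub>?G\<^esub> eval_word ?G (map (map_prod embed_word id) us)"
      by (simp add: p del: mult_free_group)
    then have "word_perm g (eval_word ?G (map (map_prod embed_word id) (p # us))) ([], z) =
      word_perm g (eval_word ?G (map (map_prod embed_word id) us)) (word_perm g ?y ([], z))"
      using word_perm_mult[where g = g, OF g] by simp
    also have "\<dots> = ([], fold push us (push p z))"
      unfolding step by (rule Cons.IH) (use Cons.prems in \<open>auto simp: reduced_push\<close>)
    finally show ?case by (simp only: fold.simps o_apply)
  qed
  \<comment> \<open>The trivial element leaves the stack empty, whereas \<open>vs\<close> leaves
    \<open>rev vs\<close> on it.\<close>
  from this[of vs "[]"] have "([], []) = ([] :: 'a list, rev vs)"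
    using ev ws_vs fold_push_reduced[OF red] by (simp add: word_perm_def)
  then show False using ws(3) ws_vs by simp
qed

end

section \<open>Parses and degree\<close>

text \<open>Decoding goes from the right: in a suffix code the last code word is determined, and
  both decodings stop at the same place because neither \<open>v\<close> nor \<open>v'\<close> ends
  with a code word.\<close>

lemma parse_unique:
  assumes bifix: "bifix_code X"
    and "v @ concat ws = v' @ concat ws'" "set ws \<subseteq> X" "set ws' \<subseteq> X"
    and v: "\<And>s. suffix s v \<Longrightarrow> s \<notin> X" and v': "\<And>s. suffix s v' \<Longrightarrow> s \<notin> X"
  shows "v = v' \<and> ws = ws'"
  using assms(2-4)
proof (induction ws arbitrary: ws' rule: rev_induct)
  case Nil
  show ?case
  proof (cases ws' rule: rev_cases)
    case (snoc us y)
    then have "suffix y v" "y \<in> X" using Nil by (auto simp: suffix_def)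
    then show ?thesis using v by blast
  qed (use Nil in simp)
next
  case (snoc y ws)
  show ?case
  proof (cases ws' rule: rev_cases)
    case Nil
    then have "suffix y v'" "y \<in> X" using snoc.prems by (auto simp: suffix_def)
    then show ?thesis using v' by blast
  next
    case (snoc us y')
    have "suffix y (v @ concat (ws @ [y]))" "suffix y' (v @ concat (ws @ [y]))"
      using snoc.prems(1) snoc by (auto simp: suffix_def) (metis append_assoc)
    then have "y = y'" using bifix_code_suffixes[OF bifix, of y y'] snoc.prems(2,3) snoc by simp
    then show ?thesis using snoc.IH[of us] snoc.prems snoc by auto
  qed
qed

lemma parse_exists:
  assumes "bifix_code X"
  shows "\<exists>v x. r = v @ x \<and> (\<forall>s. suffix s v \<longrightarrow> s \<notin> X) \<and> x \<in> word_star X"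
proof (induction r rule: length_induct)
  case (1 r)
  show ?case
  proof (cases "\<exists>y\<in>X. suffix y r")
    case True
    then obtain y q where y: "y \<in> X" "r = q @ y" by (auto simp: suffix_def)
    then have "length q < length r" using assms by (auto simp: bifix_code_def)
    then obtain v x where "q = v @ x" "\<forall>s. suffix s v \<longrightarrow> s \<notin> X" "x \<in> word_star X"
      using 1 by blast
    then show ?thesis using y append_word_star[of x X y] in_word_star[of y X]
      by (intro exI[of _ v] exI[of _ "x @ y"]) auto
  next
    case False
    then show ?thesis by (intro exI[of _ r] exI[of _ "[]"]) (auto intro: Nil_in_word_star)
  qed
qed

text \<open>The right part determines the parse: the other two arise from the rest by removing code
  words from its right end as long as possible.\<close>

lemma num_parses_eq_card_ends:
  assumes "bifix_code X"
  shows "num_parses X w = card (ends X w)"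
proof -
  have "bij_betw (\<lambda>(v, x, u). u) (parses X w) (ends X w)"
    unfolding bij_betw_def
  proof
    show "inj_on (\<lambda>(v, x, u). u) (parses X w)"
    proof (rule inj_onI, clarsimp)
      fix v x u v' x' assume p: "(v, x, u) \<in> parses X w" "(v', x', u) \<in> parses X w"
      obtain ws where ws: "x = concat ws" "set ws \<subseteq> X" using p(1) by (auto simp: parses_def word_star_def)
      obtain ws' where ws': "x' = concat ws'" "set ws' \<subseteq> X" using p(2) by (auto simp: parses_def word_star_def)
      have "v @ concat ws = v' @ concat ws'" using p ws ws' by (auto simp: parses_def)
      then show "v = v' \<and> x = x'"
        using parse_unique[OF assms, of v ws v' ws'] p ws ws' by (auto simp: parses_def)
    qed
    show "(\<lambda>(v, x, u). u) ` parses X w = ends X w"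
    proof (intro equalityI subsetI)
      fix u assume "u \<in> (\<lambda>(v, x, u). u) ` parses X w"
      then show "u \<in> ends X w"
        by (auto simp: parses_def ends_def no_prefix_def suffix_def)
    next
      fix u assume u: "u \<in> ends X w"
      then obtain r where "w = r @ u" by (auto simp: ends_def suffix_def)
      moreover obtain v x where "r = v @ x" "\<forall>s. suffix s v \<longrightarrow> s \<notin> X" "x \<in> word_star X"
        using parse_exists[OF assms] by blast
      ultimately have "(v, x, u) \<in> parses X w"
        using u by (auto simp: parses_def ends_def no_prefix_def)
      then show "u \<in> (\<lambda>(v, x, u). u) ` parses X w" by force
    qed
  qed
  then show ?thesis unfolding num_parses_def by (rule bij_betw_same_card)
qed

lemma card_ends_Cons:
  "card (ends X (b # w)) = card (ends X w) + (if no_prefix X (b # w) then 1 else 0)"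
proof (cases "no_prefix X (b # w)")
  case True
  then have "ends X (b # w) = insert (b # w) (ends X w)" by (auto simp: ends_def suffix_Cons)
  moreover have "b # w \<notin> ends X w" by (auto simp: ends_def dest: suffix_length_le)
  ultimately show ?thesis using True finite_ends[of X w] by simp
next
  case False
  then have "ends X (b # w) = ends X w" by (auto simp: ends_def suffix_Cons)
  then show ?thesis using False by simp
qed

lemma ends_snoc:
  assumes "bifix_code X"
  shows "ends X (w @ [a]) = insert [] ((\<lambda>u. u @ [a]) ` {u \<in> ends X w. u @ [a] \<notin> X})"
proof (rule Set.set_eqI)
  fix t show "t \<in> ends X (w @ [a]) \<longleftrightarrow> t \<in> insert [] ((\<lambda>u. u @ [a]) ` {u \<in> ends X w. u @ [a] \<notin> X})"
    by (cases t rule: rev_cases) (auto simp: ends_def no_prefix_Nil[OF assms] no_prefix_snoc)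
qed

text \<open>The new letter creates the state \<open>[]\<close> and removes the state that it
  completes to a code word; there is at most one, \<open>X\<close> being a suffix code.\<close>

lemma card_ends_snoc:
  assumes "bifix_code X"
  shows "card (ends X (w @ [a])) =
    card (ends X w) + (if \<exists>x\<in>X. suffix x (w @ [a]) then 0 else 1)"
proof -
  have "inj_on (\<lambda>u. u @ [a]) {u \<in> ends X w. u @ [a] \<notin> X}" by (simp add: inj_on_def)
  then have eq: "card (ends X (w @ [a])) = Suc (card {u \<in> ends X w. u @ [a] \<notin> X})"
    unfolding ends_snoc[OF assms] using finite_ends[of X w]
    by (subst card_insert_disjoint) (auto simp: card_image)
  show ?thesis
  proof (cases "\<exists>x\<in>X. suffix x (w @ [a])")
    case True
    then obtain x where x: "x \<in> X" "suffix x (w @ [a])" by blast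
    moreover have "x \<noteq> []" using assms x(1) by (auto simp: bifix_code_def)
    ultimately obtain v where v: "x = v @ [a]" "suffix v w" by (auto simp: suffix_snoc)
    then have "v \<in> ends X w" using x bifix_code_no_prefix_butlast[OF assms, of v a] by (simp add: ends_def)
    moreover have "{u \<in> ends X w. u @ [a] \<notin> X} = ends X w - {v}"
    proof -
      have "u = v" if "suffix u w" "u @ [a] \<in> X" for u
        using bifix_code_suffixes[OF assms that(2) x(1), of "w @ [a]"] that(1) x(2) v(1) by simp
      then have "u @ [a] \<notin> X \<longleftrightarrow> u \<noteq> v" if "u \<in> ends X w" for u
        using that x(1) unfolding v(1) ends_def by blast
      then show ?thesis by blast
    qed
    ultimately show ?thesis using True eq card_Suc_Diff1[OF finite_ends[of X w]] by simp
  next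
    case False
    then have "{u \<in> ends X w. u @ [a] \<notin> X} = ends X w" by (auto simp: ends_def)
    then show ?thesis using False eq by simp
  qed
qed

lemma card_ends_mono:
  assumes "bifix_code X"
  shows "card (ends X v) \<le> card (ends X (u @ v @ z))"
proof -
  have "card (ends X v) \<le> card (ends X (v @ z))"
  proof (induction z rule: rev_induct)
    case (snoc a z)
    then show ?case using card_ends_snoc[OF assms, of "v @ z" a] by simp
  qed simp
  moreover have "card (ends X t) \<le> card (ends X (u @ t))" for t
    by (induction u) (auto simp: card_ends_Cons intro: le_trans)
  ultimately show ?thesis by (meson le_trans)
qed

section \<open>Complete codes and their degree\<close>

text \<open>Maximality of a finite code enters only through this property, under which the number of
  states stays constant when a long word grows on either side.\<close>

definition complete_from :: "'a list set \<Rightarrow> 'a list set \<Rightarrow> nat \<Rightarrow> bool" where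
  "complete_from F X n \<longleftrightarrow> (\<forall>w\<in>F. n \<le> length w \<longrightarrow> \<not> no_prefix X w \<and> (\<exists>x\<in>X. suffix x w))"

context bifix_in_sturmian
begin

text \<open>Prepending letters to a long word adds no state. If \<open>w = v @ [a]\<close> had no
  suffix in \<open>X\<close>, it would have one state more than \<open>v\<close>; but recurrence
  puts \<open>w\<close> to the left of \<open>v\<close> in a factor with no more states than
  \<open>v\<close>. \<open>Suc n\<close> leaves length \<open>n\<close> for
  \<open>v\<close>.\<close>

lemma prefix_complete_imp_complete:
  assumes "\<And>w. w \<in> F \<Longrightarrow> n \<le> length w \<Longrightarrow> \<not> no_prefix X w"
  shows "complete_from F X (Suc n)"
proof -
  have left: "card (ends X (u @ w)) = card (ends X w)" if "u @ w \<in> F" "n \<le> length w" for u w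
    using that(1)
  proof (induction u)
    case (Cons b u)
    then show ?case using card_ends_Cons[of X b "u @ w"] assms[of "b # u @ w"] that(2) ConsD by simp
  qed simp
  have "\<exists>x\<in>X. suffix x w" if w: "w \<in> F" "Suc n \<le> length w" for w
  proof (rule ccontr)
    assume no: "\<not> (\<exists>x\<in>X. suffix x w)"
    obtain v a where va: "w = v @ [a]" using w by (cases w rule: rev_cases) auto
    then have v: "v \<in> F" "n \<le> length v" using w appendD1 by auto
    obtain z where z: "w @ z @ v \<in> F" using recurrent[OF w(1) v(1)] by blast
    have "card (ends X w) \<le> card (ends X ((w @ z) @ v))"
      using card_ends_mono[OF bifix, of w "[]" "z @ v"] by simp
    also have "\<dots> = card (ends X v)" using left[of "w @ z" v] z v(2) by simp
    finally have le: "card (ends X (v @ [a])) \<le> card (ends X v)" by (simp add: va)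
    have "card (ends X (v @ [a])) = card (ends X v) + 1"
      using no unfolding va card_ends_snoc[OF bifix] by (simp only: if_False)
    then show False using le by simp
  qed
  then show ?thesis using assms by (auto simp: complete_from_def)
qed

text \<open>The mirror argument: \<open>w = b # v\<close> is placed to the right of
  \<open>v\<close>.\<close>

lemma suffix_complete_imp_complete:
  assumes "\<And>w. w \<in> F \<Longrightarrow> n \<le> length w \<Longrightarrow> \<exists>x\<in>X. suffix x w"
  shows "complete_from F X (Suc n)"
proof -
  have right: "card (ends X (w @ u)) = card (ends X w)" if "w @ u \<in> F" "n \<le> length w" for u w
    using that(1)
  proof (induction u rule: rev_induct)
    case (snoc a u)
    then show ?case using card_ends_snoc[OF bifix, of "w @ u" a] assms[of "w @ u @ [a]"] that(2)
        appendD1[of "w @ u" "[a]"] by simp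
  qed simp
  have "\<not> no_prefix X w" if w: "w \<in> F" "Suc n \<le> length w" for w
  proof
    assume no: "no_prefix X w"
    obtain b v where bv: "w = b # v" using w by (cases w) auto
    then have v: "v \<in> F" "n \<le> length v" using w ConsD by auto
    obtain z where z: "v @ z @ w \<in> F" using recurrent[OF v(1) w(1)] by blast
    have "card (ends X w) \<le> card (ends X (v @ z @ w))"
      using card_ends_mono[OF bifix, of w "v @ z" "[]"] by simp
    also have "\<dots> = card (ends X v)" using right[OF z v(2)] .
    finally show False using card_ends_Cons[of X b v] no bv by simp
  qed
  then show ?thesis using assms by (auto simp: complete_from_def)
qed

text \<open>If there were long words without prefix in \<open>X\<close> and long words without suffix in \<open>X\<close>,
  recurrence would combine two of them into a word that can be added to \<open>X\<close>.\<close>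

lemma maximal_imp_complete:
  assumes fin: "finite X" and max: "F_maximal_bifix F X"
  shows "\<exists>n. complete_from F X n"
proof -
  obtain m where m: "\<And>x. x \<in> X \<Longrightarrow> length x \<le> m"
    using fin by (metis finite_imageI finite_nat_set_iff_bounded_le imageI)
  show ?thesis
  proof (rule ccontr)
    assume no: "\<nexists>n. complete_from F X n"
    obtain u where u: "u \<in> F" "Suc m \<le> length u" "no_prefix X u"
      using no prefix_complete_imp_complete by blast
    obtain v where v: "v \<in> F" "Suc m \<le> length v" "\<not> (\<exists>x\<in>X. suffix x v)"
      using no suffix_complete_imp_complete by blast
    obtain z where z: "u @ z @ v \<in> F" using recurrent u v by blast
    let ?y = "u @ z @ v"
    have len: "length x < length ?y" if "x \<in> X" for x using m[OF that] u(2) by simp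
    have pre: "\<not> prefix x ?y" if "x \<in> X" for x
    proof
      assume "prefix x ?y"
      moreover have "prefix u ?y" by simp
      ultimately have "prefix x u"
        using prefix_same_cases[of x ?y u] prefix_length_le[of u x] m[OF that] u(2) by linarith
      then show False using u(3) that by (simp add: no_prefix_def)
    qed
    have suf: "\<not> suffix x ?y" if "x \<in> X" for x
    proof
      assume "suffix x ?y"
      moreover have "suffix v ?y" by (simp add: suffix_def)
      ultimately have "suffix x v"
        using suffix_same_cases[of x ?y v] suffix_length_le[of v x] m[OF that] v(2) by linarith
      then show False using v(3) that by blast
    qed
    have "bifix_code (insert ?y X)"
      unfolding bifix_code_def
    proof (intro conjI ballI)
      fix s t assume s: "s \<in> insert ?y X" and t: "t \<in> insert ?y X"
      show "s \<noteq> []" using s u(2) bifix by (auto simp: bifix_code_def)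
      have long: "\<not> prefix ?y x" "\<not> suffix ?y x" if "x \<in> X" for x
        using len[OF that] prefix_length_le[of ?y x] suffix_length_le[of ?y x] by linarith+
      show "\<not> strict_prefix s t"
        using s t pre long bifix unfolding bifix_code_def strict_prefix_def by blast
      show "\<not> strict_suffix s t"
        using s t suf long bifix unfolding bifix_code_def strict_suffix_def by blast
    qed
    then have "insert ?y X = X" using max z XF unfolding F_maximal_bifix_def by blast
    then show False using len[of ?y] by blast
  qed
qed

text \<open>Recurrence places any factor to the left of \<open>w\<close>, and prepending letters to
  \<open>w\<close> adds no state, so \<open>w\<close> attains the maximum.\<close>

lemma card_ends_complete:
  assumes c: "complete_from F X n" and deg: "F_degree F X = enat d"
    and w: "w \<in> F" "n \<le> length w"
  shows "card (ends X w) = d"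
proof -
  have le: "card (ends X v) \<le> card (ends X w)" if v: "v \<in> F" for v
  proof -
    obtain z where z: "v @ z @ w \<in> F" using recurrent v w by blast
    have left: "card (ends X (u @ w)) = card (ends X w)" if "u @ w \<in> F" for u
      using that
    proof (induction u)
      case (Cons b u)
      then show ?case using card_ends_Cons[of X b "u @ w"] c w(2) ConsD[of b "u @ w"]
        by (simp add: complete_from_def)
    qed simp
    have "card (ends X v) \<le> card (ends X (v @ z @ w))"
      using card_ends_mono[OF bifix, of v "[]" "z @ w"] by simp
    then show ?thesis using left[of "v @ z"] z by simp
  qed
  have "F_degree F X = enat (card (ends X w))"
    unfolding F_degree_def num_parses_eq_card_ends[OF bifix]
    by (intro antisym SUP_least SUP_upper2[OF w(1)]) (use le in auto)
  then show ?thesis using deg by simp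
qed

section \<open>The index of the subgroup generated by a complete code\<close>

text \<open>A vertex has a prefix in \<open>X\<close>, so it is not a state of its own and no state
  outgrows it; the empty state over \<open>tl e\<close> is reached because \<open>tl e\<close> ends
  with a code word.\<close>

lemma read_letter_ends:
  assumes c: "complete_from F X n" and e: "e \<in> F" "length e = Suc n"
  shows "read_letter X c (last e) ` (ends X (butlast e) \<times> (UNIV :: unit set)) = ends X (tl e) \<times> UNIV"
proof -
  obtain w a where wa: "e = w @ [a]" using e by (cases e rule: rev_cases) auto
  have w: "w \<in> F" "length w = n" using e wa appendD1 by auto
  then have nw: "\<not> no_prefix X w" using c by (simp add: complete_from_def)
  then obtain b w' where bw: "w = b # w'" using no_prefix_Nil[OF bifix] by (cases w) auto
  have tl: "tl e = w' @ [a]" by (simp add: wa bw)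
  have "\<exists>x\<in>X. suffix x (w' @ [a])"
    using c tl_in[OF e(1)] e(2) unfolding tl[symmetric] complete_from_def by force
  then obtain x' where x': "x' @ [a] \<in> X" "suffix x' w'"
    using bifix by (metis bifix_code_def rev_exhaust suffix_snoc)
  have "ends X w = ends X w'" using nw by (auto simp: bw ends_def suffix_Cons)
  moreover have "x' \<in> ends X w'"
    using x' bifix_code_no_prefix_butlast[OF bifix] by (simp add: ends_def)
  ultimately show ?thesis
    unfolding tl ends_snoc[OF bifix] using x'(1)
    by (auto simp: wa read_letter_def image_iff split: if_splits) force+
qed

text \<open>The free group acts transitively on the common set \<open>E0\<close> of states, and
  \<open>\<tau>\<close> turns this action into right multiplication of cosets. Since the subgroup
  fixes the base state, states and cosets correspond one to one.\<close>

lemma complete_index: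
  assumes c: "complete_from F X n" and n: "\<And>x. x \<in> X \<Longrightarrow> length x \<le> n"
    and w0: "w0 \<in> F" "length w0 = n"
  shows "card (rcosets\<^bsub>free_group A\<^esub> (generate (free_group A) (embed_word ` X))) = card (ends X w0)"
proof -
  let ?G = "free_group A" and ?H = "generate (free_group A) (embed_word ` X)"
  interpret group ?G by (rule group_free_group)
  note [simp del] = mult_free_group one_free_group
  have H: "subgroup ?H ?G" by (rule generate_is_subgroup[OF code_carrier])
  interpret H: subgroup ?H ?G by (rule H)
  define E :: "'a list \<Rightarrow> ('a list \<times> unit) set" where "E w = ends X w \<times> UNIV" for w
  define \<tau> where "\<tau> s = ?H #>\<^bsub>?G\<^esub> embed_word (fst s)" for s :: "'a list \<times> unit"
  define act where "act a K = K #>\<^bsub>?G\<^esub> [(a, False)]" for a and K :: "('a \<times> bool) list set"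
  let ?k = "read_letter X (\<lambda>_. id :: unit \<Rightarrow> unit)"
  let ?s0 = "([], ()) :: 'a list \<times> unit"
  have letter: "[(a, b)] \<in> carrier ?G" if "a \<in> A" for a b
    using that by (simp add: carrier_free_group)
  have letter_embed: "[(a, False)] = embed_word [a]" for a :: 'a by (simp add: embed_word_def)
  have rc: "K \<subseteq> carrier ?G" if "K \<in> rcosets\<^bsub>?G\<^esub> ?H" for K
    using that H.rcosets_carrier[OF group_axioms] by blast
  have Ecar: "embed_word (fst s) \<in> carrier ?G" if "w \<in> F" "s \<in> E w" for w s
  proof -
    have "set (fst s) \<subseteq> set w" using that(2) by (auto simp: E_def ends_def suffix_def)
    then show ?thesis using letters[OF that(1)] by (intro embed_word_carrier) blast
  qed
  have code_coset: "?H #>\<^bsub>?G\<^esub> embed_word x = ?H #>\<^bsub>?G\<^esub> embed_word []" if "x \<in> X" for x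
  proof -
    have "?H #>\<^bsub>?G\<^esub> embed_word x = ?H"
      by (rule H.rcos_const[OF group_axioms generate.incl]) (use that in blast)
    moreover have "?H #>\<^bsub>?G\<^esub> embed_word [] = ?H"
      using coset_mult_one[OF H.subset] by (simp add: embed_word_def one_free_group)
    ultimately show ?thesis by simp
  qed
  obtain g h E0 where cov: "(\<forall>a. bij (g a))
    \<and> (\<forall>w\<in>F. length w = n \<longrightarrow> bij (h w) \<and> h w ` E w = E0 \<and> (\<forall>z. h w ([], z) = ([], z))
          \<and> (\<forall>s\<in>E w. \<tau> (h w s) = \<tau> s))
    \<and> (\<forall>e\<in>F. length e = Suc n \<longrightarrow> (\<forall>s\<in>E (butlast e).
          g (last e) (h (butlast e) s) = h (tl e) (?k (last e) s)))
    \<and> (\<forall>y w z. length y = n \<and> y @ w \<in> F \<and> length w \<le> n \<longrightarrow>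
          fold g w ([], z) = h (drop (length w) (y @ w)) (fold ?k w ([], z)))"
  proof (atomize_elim, rule covering[where C = "rcosets\<^bsub>?G\<^esub> ?H" and act = act])
    show "?k (last e) ` E (butlast e) = E (tl e)" if "e \<in> F" "length e = Suc n" for e
      unfolding E_def by (rule read_letter_ends[OF c that])
    show "\<tau> s \<in> rcosets\<^bsub>?G\<^esub> ?H" if "w \<in> F" "s \<in> E w" for w s
      using Ecar[OF that] by (auto simp: \<tau>_def RCOSETS_def)
    show "\<tau> (?k (last e) s) = act (last e) (\<tau> s)"
      if e: "e \<in> F" "length e = Suc n" and s: "s \<in> E (butlast e)" for e s
    proof -
      have "last e \<in> A" using e letters by (metis Zero_not_Suc last_in_set list.size(3) subsetD)
      then have "act (last e) (\<tau> s) = ?H #>\<^bsub>?G\<^esub> embed_word (fst s @ [last e])"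
        unfolding act_def \<tau>_def embed_word_append[of _ _ A] letter_embed[symmetric]
        using Ecar[OF butlast_in[OF e(1)] s] letter by (simp add: coset_mult_assoc H.subset)
      then show ?thesis using code_coset by (simp add: \<tau>_def read_letter_def)
    qed
    show "inj_on (act a) (rcosets\<^bsub>?G\<^esub> ?H)" if "a \<in> A" for a
    proof (rule inj_on_inverseI)
      fix K assume "K \<in> rcosets\<^bsub>?G\<^esub> ?H"
      then show "act a K #>\<^bsub>?G\<^esub> (inv\<^bsub>?G\<^esub> [(a, False)]) = K"
        using letter[OF that] rc by (simp add: act_def coset_mult_assoc coset_mult_one)
    qed
    show "bij (id :: unit \<Rightarrow> unit)" by simp
  qed (auto simp: E_def)
  note g = cov[THEN conjunct1, rule_format] and h = cov[THEN conjunct2, THEN conjunct1, rule_format]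
    and gh = cov[THEN conjunct2, THEN conjunct2, THEN conjunct1, rule_format]
    and path = cov[THEN conjunct2, THEN conjunct2, THEN conjunct2, rule_format]
  have \<tau>C: "\<tau> s \<in> rcosets\<^bsub>?G\<^esub> ?H" if s: "s \<in> E0" for s
  proof -
    obtain t where "t \<in> E w0" "s = h w0 t" using h[OF w0] s by blast
    then show ?thesis using h[OF w0] Ecar[OF w0(1), of t] by (auto simp: \<tau>_def RCOSETS_def)
  qed
  have g_E0: "g a ` E0 = E0 \<and> (\<forall>s\<in>E0. \<tau> (g a s) = act a (\<tau> s))" if a: "a \<in> A" for a
  proof -
    \<comment> \<open>Every letter labels some edge, and a single edge shows how \<open>g a\<close>
      acts, because \<open>E0\<close> is the image of the states over any vertex.\<close>
    obtain y where y: "length y = n" "y @ [a] \<in> F"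
      using left_extendable_length[OF letter_in[OF a]] by blast
    define e where "e = y @ [a]"
    have e: "e \<in> F" "length e = Suc n" "butlast e = y" "last e = a" "y \<in> F"
      using y appendD1 by (auto simp: e_def)
    have te: "tl e \<in> F" "length (tl e) = n" using e tl_in by auto
    have kE: "?k a ` E y = E (tl e)" using read_letter_ends[OF c e(1,2)] e unfolding E_def by simp
    have E0y: "E0 = h y ` E y" using h[OF e(5) y(1)] by blast
    have gs: "g a (h y s) = h (tl e) (?k a s)" if "s \<in> E y" for s
      using gh[OF e(1,2), of s] e that by simp
    have "g a ` E0 = h (tl e) ` ?k a ` E y"
      unfolding E0y image_image using gs by (rule image_cong[OF refl])
    then have "g a ` E0 = E0" using kE h[OF te] by simp
    moreover have "\<tau> (g a s) = act a (\<tau> s)" if s: "s \<in> E0" for s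
    proof -
      obtain t where t: "t \<in> E y" "s = h y t" using E0y s by blast
      have kt: "?k a t \<in> E (tl e)" using t kE by blast
      have "\<tau> (g a s) = \<tau> (?k a t)" using gs[OF t(1)] t h[OF te] kt by simp
      also have "\<dots> = ?H #>\<^bsub>?G\<^esub> embed_word (fst t @ [a])"
        using code_coset by (simp add: \<tau>_def read_letter_def)
      also have "\<dots> = act a (\<tau> t)"
        unfolding act_def \<tau>_def embed_word_append[of _ _ A] letter_embed[symmetric]
        using Ecar[OF e(5) t(1)] letter[OF a] by (simp add: coset_mult_assoc H.subset)
      also have "\<tau> t = \<tau> s" using t h[OF e(5) y(1)] by simp
      finally show ?thesis .
    qed
    ultimately show ?thesis by blast
  qed
  have word: "word_perm g v s \<in> E0 \<and> \<tau> (word_perm g v s) = \<tau> s #>\<^bsub>?G\<^esub> v"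
    if "v \<in> carrier ?G" "s \<in> E0" for v s
    using that(1)
  proof (induction v rule: rev_induct)
    case Nil
    have "\<tau> s #>\<^bsub>?G\<^esub> [] = \<tau> s"
      using coset_mult_one[OF rc[OF \<tau>C[OF that(2)]]] by (simp add: one_free_group)
    then show ?case using that(2) by (simp add: word_perm_def)
  next
    case (snoc p v)
    note v = snoc_free_group[OF snoc.prems]
    let ?t = "word_perm g v s"
    have t: "?t \<in> E0" "\<tau> ?t = \<tau> s #>\<^bsub>?G\<^esub> v" using snoc.IH[OF v(1)] by auto
    obtain a b where p: "p = (a, b)" by force
    have a: "a \<in> A" using v(2) by (simp add: p carrier_free_group)
    have "letter_perm g p ?t \<in> E0 \<and> \<tau> (letter_perm g p ?t) = \<tau> ?t #>\<^bsub>?G\<^esub> [p]"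
    proof (cases b)
      case False
      then show ?thesis using g_E0[OF a] t(1) by (auto simp: p letter_perm_def act_def)
    next
      case True
      obtain t' where t': "t' \<in> E0" "g a t' = ?t" using g_E0[OF a] t(1) by (metis imageE)
      then have l: "letter_perm g p ?t = t'"
        using True inv_f_f[OF bij_is_inj[OF g[of a]], of t'] by (simp add: p letter_perm_def)
      have "\<tau> ?t #>\<^bsub>?G\<^esub> [p] = \<tau> t' #>\<^bsub>?G\<^esub> ([(a, False)] \<otimes>\<^bsub>?G\<^esub> inv\<^bsub>?G\<^esub> [(a, False)])"
        using g_E0[OF a] t' True letter[OF a] rc[OF \<tau>C[OF t'(1)]] inv_letter_free_group[OF a, of False]
        by (simp add: p act_def coset_mult_assoc flip: t'(2))
      then show ?thesis using t'(1) l letter[OF a] rc[OF \<tau>C[OF t'(1)]] by (simp add: coset_mult_one)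
    qed
    moreover have "\<tau> ?t #>\<^bsub>?G\<^esub> [p] = \<tau> s #>\<^bsub>?G\<^esub> (v @ [p])"
      unfolding t(2) v(3) using v rc[OF \<tau>C[OF that(2)]] by (simp add: coset_mult_assoc)
    ultimately show ?case by (simp add: word_perm_def)
  qed
  have "[] \<in> ends X w0" by (simp add: ends_def no_prefix_Nil[OF bifix])
  then have s0: "?s0 \<in> E0" using h[OF w0] by (metis (no_types) E_def SigmaI UNIV_I image_eqI)
  have \<tau>s0: "\<tau> ?s0 = ?H"
    using coset_mult_one[OF H.subset] by (simp add: \<tau>_def embed_word_def one_free_group)
  have reach: "\<exists>u. u \<in> carrier ?G \<and> s = word_perm g u ?s0" if s: "s \<in> E0" for s
  proof -
    have "s \<in> h w0 ` E w0" using h[OF w0] s by simp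
    then obtain u where u: "u \<in> ends X w0" "s = h w0 (u, ())" by (auto simp: E_def)
    then obtain r where r: "w0 = r @ u" by (auto simp: ends_def suffix_def)
    obtain y0 where y0: "length y0 = n" "y0 @ w0 \<in> F" using left_extendable_length[OF w0(1)] by blast
    \<comment> \<open>This context makes the reading of \<open>u\<close> end exactly at the vertex
      \<open>w0\<close>: \<open>y @ u\<close> is \<open>y0 @ w0\<close> without its first
      \<open>length r\<close> letters.\<close>
    define y where "y = drop (length r) (y0 @ r)"
    have y: "length y = n" "length u \<le> n" using y0 w0 r by (auto simp: y_def)
    have yu: "y @ u = drop (length r) (y0 @ w0)" using y0 w0 r by (simp add: y_def)
    then have "y @ u \<in> F" using drop_in[OF y0(2)] by metis
    moreover have "drop (length u) (y @ u) = w0" unfolding yu using y0 w0 r by (simp add: add.commute)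
    ultimately have "fold g u ?s0 = h w0 (fold ?k u ?s0)" using path[of y u "()"] y by simp
    also have "\<dots> = s" using u fold_read_letter_no_prefix[of X u "\<lambda>_. id" "()"] by (simp add: ends_def)
    finally have "s = word_perm g (embed_word u) ?s0" by (simp add: word_perm_embed_word)
    moreover have "embed_word u \<in> carrier ?G" using Ecar[OF w0(1), of "(u, ())"] u by (simp add: E_def)
    ultimately show ?thesis by blast
  qed
  have fix_s0: "word_perm g t ?s0 = ?s0" if "t \<in> ?H" for t
  proof (rule word_perm_generate_fixes[OF g code_carrier _ that])
    fix y assume "y \<in> embed_word ` X"
    then obtain x where x: "x \<in> X" "y = embed_word x" by blast
    obtain y' where y': "length y' = n" "y' @ x \<in> F" using left_extendable_length x XF by blast
    let ?v = "drop (length x) (y' @ x)"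
    have v: "?v \<in> F" "length ?v = n" using y'(1) drop_in[OF y'(2)] by simp_all
    have "fold g x ?s0 = h ?v (fold ?k x ?s0)" using path[of y' x "()"] y' n[OF x(1)] by blast
    also have "\<dots> = ?s0" using fold_read_letter_code[OF bifix x(1), of "\<lambda>_. id" "()"] h[OF v] by simp
    finally show "word_perm g y ?s0 = ?s0" by (simp add: x(2) word_perm_embed_word)
  qed
  have "bij_betw \<tau> E0 (rcosets\<^bsub>?G\<^esub> ?H)"
    unfolding bij_betw_def
  proof
    show "inj_on \<tau> E0"
    proof (rule inj_onI)
      fix s t assume st: "s \<in> E0" "t \<in> E0" "\<tau> s = \<tau> t"
      obtain u where u: "u \<in> carrier ?G" "s = word_perm g u ?s0" using reach st by blast
      obtain v where v: "v \<in> carrier ?G" "t = word_perm g v ?s0" using reach st by blast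
      have "?H #>\<^bsub>?G\<^esub> u = ?H #>\<^bsub>?G\<^esub> v"
        using word[OF u(1) s0] word[OF v(1) s0] st(3) u v \<tau>s0 by simp
      then have "v \<in> ?H #>\<^bsub>?G\<^esub> u" using rcos_self[OF v(1) H] by simp
      then obtain q where q: "q \<in> ?H" "v = q \<otimes>\<^bsub>?G\<^esub> u" by (auto simp: r_coset_def)
      then show "s = t" using u v fix_s0[OF q(1)] word_perm_mult[where g = g and u = q and v = u and A = A, OF g]
        by simp
    qed
    show "\<tau> ` E0 = rcosets\<^bsub>?G\<^esub> ?H"
    proof
      show "\<tau> ` E0 \<subseteq> rcosets\<^bsub>?G\<^esub> ?H" using \<tau>C by blast
      show "rcosets\<^bsub>?G\<^esub> ?H \<subseteq> \<tau> ` E0"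
      proof
        fix K assume "K \<in> rcosets\<^bsub>?G\<^esub> ?H"
        then obtain v where v: "v \<in> carrier ?G" "K = ?H #>\<^bsub>?G\<^esub> v" by (auto simp: RCOSETS_def)
        then show "K \<in> \<tau> ` E0" using word[OF v(1) s0] \<tau>s0 by (metis imageI)
      qed
    qed
  qed
  then have "card (rcosets\<^bsub>?G\<^esub> ?H) = card E0" by (rule bij_betw_same_card[symmetric])
  also have "E0 = h w0 ` E w0" using h[OF w0] by simp
  also have "card (h w0 ` E w0) = card (E w0)"
    using h[OF w0] by (intro card_image) (meson bij_is_inj inj_on_subset subset_UNIV)
  also have "\<dots> = card (ends X w0)" by (simp add: E_def card_cartesian_product)
  finally show ?thesis .
qed

section \<open>The two implications\<close>

lemma maximal_imp_finite_index_basis: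
  assumes fin: "finite X" and max: "F_maximal_bifix F X" and deg: "F_degree F X = enat d"
  defines "H \<equiv> generate (free_group A) (embed_word ` X)"
  shows "subgroup H (free_group A)" "free_basis (free_group A) (embed_word ` X) H"
    "card (rcosets\<^bsub>free_group A\<^esub> H) = d"
proof -
  interpret group "free_group A" by (rule group_free_group)
  show "subgroup H (free_group A)" unfolding H_def by (rule generate_is_subgroup[OF code_carrier])
  show "free_basis (free_group A) (embed_word ` X) H"
    using finite_code_free[OF fin] by (auto simp: free_basis_def H_def intro: generate.incl)
  obtain n0 where n0: "complete_from F X n0" using maximal_imp_complete[OF fin max] by blast
  \<comment> \<open>Vertices must be long enough both for completeness and for reading a whole code
    word.\<close>
  obtain n where n: "n0 \<le> n" "\<And>x. x \<in> X \<Longrightarrow> length x \<le> n"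
    using fin by (metis finite_imageI finite_nat_set_iff_bounded_le imageI nat_le_linear order_trans)
  obtain w where w: "w \<in> F" "length w = n" using ex_length by blast
  have "complete_from F X n" using n0 n(1) by (auto simp: complete_from_def)
  then show "card (rcosets\<^bsub>free_group A\<^esub> H) = d"
    using complete_index[OF _ n(2) w] card_ends_complete[OF n0 deg w(1)] n(1) w(2)
    by (simp add: H_def)
qed

lemma finite_index_basis_imp_maximal:
  assumes A: "finite A" and H: "subgroup H (free_group A)"
    and basis: "free_basis (free_group A) (embed_word ` X) H"
    and index: "card (rcosets\<^bsub>free_group A\<^esub> H) = d" and d: "d \<ge> 1"
  shows "finite X \<and> F_maximal_bifix F X \<and> F_degree F X = enat d"
proof -
  let ?G = "free_group A"
  interpret group ?G by (rule group_free_group)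
  interpret H: subgroup H ?G by (rule H)
  note [simp del] = mult_free_group one_free_group
  \<comment> \<open>An infinite set has \<open>card\<close> 0, so \<open>d \<ge> 1\<close> makes the
    index finite.\<close>
  have finr: "finite (rcosets\<^bsub>?G\<^esub> H)" using index d card.infinite by fastforce
  have "finite (embed_word ` X)" by (rule free_basis_finite_index_finite[OF A H finr basis])
  then have fin: "finite X" using inj_embed_word by (meson finite_imageD inj_on_subset subset_UNIV)
  have gen: "generate ?G (embed_word ` X) = H" using basis by (simp add: free_basis_def)
  have emb: "embed_word w \<in> carrier ?G" if "w \<in> F" for w using letters[OF that] by (rule embed_word_carrier)
  txt \<open>By saturation, distinct suffixes without prefix in \<open>X\<close> of a word of \<open>F\<close> lie in distinct cosets.\<close>
  have bound: "card (ends X w) \<le> d" if w: "w \<in> F" for w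
  proof -
    let ?r = "\<lambda>u. H #>\<^bsub>?G\<^esub> embed_word u"
    have inj: "u = v" if uv: "u \<in> ends X w" "suffix v u" "?r u = ?r v" for u v
    proof (rule ccontr)
      assume "u \<noteq> v"
      then obtain z where z: "u = z @ v" "z \<noteq> []" using uv(2) by (auto simp: suffix_def)
      obtain q where "w = q @ u" using uv(1) by (auto simp: ends_def suffix_def)
      then have uF: "u \<in> F" using w appendD2 by blast
      then have F: "z \<in> F" "v \<in> F" using uF z appendD1[of z v] appendD2[of z v] by auto
      have "embed_word u = embed_word z \<otimes>\<^bsub>?G\<^esub> embed_word v" using z embed_word_append by blast
      moreover have "embed_word u \<in> ?r v" using rcos_self[OF emb[OF uF] H] uv(3) by simp
      ultimately have "embed_word z \<otimes>\<^bsub>?G\<^esub> embed_word v \<in> ?r v" by simp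
      then obtain q where q: "q \<in> H" "embed_word z \<otimes>\<^bsub>?G\<^esub> embed_word v = q \<otimes>\<^bsub>?G\<^esub> embed_word v"
        unfolding r_coset_def by blast
      \<comment> \<open>Cancelling \<open>v\<close> leaves \<open>z\<close> in \<open>H\<close>; by
        saturation \<open>z\<close> starts with a code word, which would be a prefix of the state
        \<open>u\<close>.\<close>
      then have "embed_word z = q"
        using right_cancel[of "embed_word v" "embed_word z" q] emb F H.subset by auto
      then have "z \<in> word_star X" using saturation[OF fin F(1)] q(1) gen by simp
      then obtain x where "x \<in> X" "prefix x z"
        using word_star_ConsE[OF _ z(2)] bifix by (auto simp: bifix_code_def)
      then show False using uv(1) z by (auto simp: ends_def no_prefix_def)
    qed
    have "inj_on ?r (ends X w)"
    proof (rule inj_onI)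
      fix u v assume uv: "u \<in> ends X w" "v \<in> ends X w" "?r u = ?r v"
      then consider "suffix u v" | "suffix v u" using suffix_same_cases by (auto simp: ends_def)
      then show "u = v" using inj[of u v] inj[of v u] uv by cases auto
    qed
    moreover have "?r ` ends X w \<subseteq> rcosets\<^bsub>?G\<^esub> H"
    proof
      fix K assume "K \<in> ?r ` ends X w"
      then obtain u where u: "u \<in> ends X w" "K = ?r u" by blast
      then obtain q where "w = q @ u" by (auto simp: ends_def suffix_def)
      then have "u \<in> F" using w appendD2 by blast
      then show "K \<in> rcosets\<^bsub>?G\<^esub> H" using u emb by (auto simp: RCOSETS_def)
    qed
    ultimately show ?thesis using card_inj_on_le[OF _ _ finr] index by blast
  qed
  define M where "M = Max ((\<lambda>w. card (ends X w)) ` F)"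
  have finM: "finite ((\<lambda>w. card (ends X w)) ` F)"
    by (rule finite_subset[of _ "{..d}"]) (use bound in auto)
  have le_M: "card (ends X w) \<le> M" if "w \<in> F" for w using finM that by (simp add: M_def)
  have "M \<in> (\<lambda>w. card (ends X w)) ` F" unfolding M_def using finM Nil_in by (intro Max_in) auto
  then obtain w where w: "w \<in> F" "card (ends X w) = M" by blast
  have deg: "F_degree F X = enat M"
    unfolding F_degree_def num_parses_eq_card_ends[OF bifix]
    by (intro antisym SUP_least SUP_upper2[OF w(1)]) (use le_M w in auto)
  have max: "F_maximal_bifix F X"
    unfolding F_maximal_bifix_def
  proof (intro conjI allI impI)
    fix Y assume Y: "bifix_code Y \<and> X \<subseteq> Y \<and> Y \<subseteq> F"
    show "Y = X"
    proof (intro equalityI subsetI)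
      fix y assume y: "y \<in> Y"
      then obtain b y' where by': "y = b # y'" using Y by (cases y) (auto simp: bifix_code_def)
      \<comment> \<open>A word ending with \<open>w\<close> already has \<open>M\<close> states
        without its first letter \<open>b\<close>, so \<open>y @ z @ w\<close> is not a state and
        has a prefix in \<open>X\<close>. That prefix is comparable with \<open>y\<close>, hence
        equal to it in the bifix code \<open>Y\<close>.\<close>
      obtain z where z: "y @ z @ w \<in> F" using recurrent w(1) y Y by blast
      let ?v = "y' @ z @ w"
      have v: "?v \<in> F" "b # ?v \<in> F" using z by' ConsD[of b ?v] by auto
      have "M \<le> card (ends X ?v)" using card_ends_mono[OF bifix, of w "y' @ z" "[]"] w(2) by simp
      then have "\<not> no_prefix X (b # ?v)"
        using card_ends_Cons[of X b ?v] le_M[OF v(2)] by (auto split: if_splits)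
      then obtain x where x: "x \<in> X" "prefix x (y @ z @ w)" by (auto simp: no_prefix_def by')
      moreover have "prefix y (y @ z @ w)" by simp
      ultimately have "prefix x y \<or> prefix y x" using prefix_same_cases by blast
      then have "x = y" using Y x y bifix_code_prefix[of Y x y] bifix_code_prefix[of Y y x] by blast
      then show "y \<in> X" using x by simp
    qed (use Y in blast)
  qed (use bifix XF in auto)
  \<comment> \<open>The direct implication, applied with degree \<open>M\<close>, computes the index
    as \<open>M\<close>; hence \<open>M = d\<close>.\<close>
  have "card (rcosets\<^bsub>?G\<^esub> H) = M"
    using maximal_imp_finite_index_basis(3)[OF fin max deg] gen by simp
  then show ?thesis using fin max deg index by simp
qed

end

theorem mainTheorem15:
  fixes A :: "'a set" and F X :: "'a list set" and d :: nat
  assumes "finite A"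
    and "sturmian_set A F"
    and "d \<ge> 1"
    and "bifix_code X" and "X \<subseteq> F"
  shows "(\<exists>H. subgroup H (free_group A) \<and> free_basis (free_group A) (embed_word ` X) H
              \<and> card (rcosets\<^bsub>free_group A\<^esub> H) = d)
     \<longleftrightarrow> (finite X \<and> F_maximal_bifix F X \<and> F_degree F X = enat d)"
proof -
  interpret sturmian_language A F by (rule sturmian_set_language[OF assms(2)])
  interpret bifix_in_sturmian A F X by unfold_locales (rule assms)+
  show ?thesis
    using finite_index_basis_imp_maximal[OF assms(1) _ _ _ assms(3)] maximal_imp_finite_index_basis
    by blast
qed

end
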